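(* Let $X_1,X_2,\dots$ be i.i.d. random variables with density $f$ and distribution function $F$. Assume that $f$ has support on $(0,\infty)$ and that $f'$ is bounded. Let $K$ be a kernel density function with $\int_{-\infty}^{\infty}|t|K(t)\,dt<\infty$, and let $(h_n)$ be a sequence of positive bandwidths with $h_n\to0$, $nh_n\to\infty$ and $h_n^{-1}n^{-1/2}(\log\log n)^{1/2}\to0$ as $n\to\infty$. Then for every $0<t_1<t_2<\infty$ with $F(t_1)<F(t_2)$, $$\lim_{n\to\infty}|\widetilde{IV}(t_1,t_2)-IV(t_1,t_2)|=0\quad\text{almost surely}.$$
   Context: For $F(t_1)<F(t_2)$ the interval varextropy is $$IV(t_1,t_2)=\frac{1}{4(F(t_2)-F(t_1))^3}\int_{t_1}^{t_2} f(x)^3\,dx-\frac{1}{4(F(t_2)-F(t_1))^4}\Big(\int_{t_1}^{t_2} f(x)^2\,dx\Big)^2.$$ Let $F_n(x)=\frac1n\sum_{i=1}^n I(X_i\le x)$ be the empirical distribution function and $f_n(x)=\frac{1}{nh_n}\sum_{i=1}^n K\big(\frac{x-X_i}{h_n}\big)$ the kernel density estimator based on $X_1,\dots,X_n$. The estimator is $$\widetilde{IV}(t_1,t_2)=\frac{1}{4(F_n(t_2)-F_n(t_1))^3}\int_{t_1}^{t_2} f_n(x)^3\,dx-\frac{1}{4(F_n(t_2)-F_n(t_1))^4}\Big(\int_{t_1}^{t_2} f_n(x)^2\,dx\Big)^2.$$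
   Formalization: The kernel K is additionally assumed to have integrable cube, ∫K(t)^3 dt < ∞ (automatic for bounded kernels); without it, e.g. for K(t)=|t|^{-1/2}/4 on [-1,1], the integrals of f_n^2 and f_n^3 diverge and the estimator is undefined. *)

theory Defs
  imports "HOL-Probability.Probability"
begin

definition interval_varextropy :: "(real \<Rightarrow> real) \<Rightarrow> (real \<Rightarrow> real) \<Rightarrow> real \<Rightarrow> real \<Rightarrow> real" where
  "interval_varextropy F f t1 t2 =
     1 / (4 * (F t2 - F t1) ^ 3) * (LBINT x:{t1..t2}. f x ^ 3)
     - 1 / (4 * (F t2 - F t1) ^ 4) * (LBINT x:{t1..t2}. f x ^ 2) ^ 2"

(* In the next three definitions x is one realization of the sample sequence; x 0 is not used. *)

definition empirical_cdf :: "(nat \<Rightarrow> real) \<Rightarrow> nat \<Rightarrow> real \<Rightarrow> real" where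
  "empirical_cdf x n t = 1 / real n * (\<Sum>i = 1..n. indicator {..t} (x i))"

definition kernel_density_estimator ::
    "(real \<Rightarrow> real) \<Rightarrow> (nat \<Rightarrow> real) \<Rightarrow> (nat \<Rightarrow> real) \<Rightarrow> nat \<Rightarrow> real \<Rightarrow> real" where
  "kernel_density_estimator K h x n t =
     1 / (real n * h n) * (\<Sum>i = 1..n. K ((t - x i) / h n))"

definition interval_varextropy_estimator ::
    "(real \<Rightarrow> real) \<Rightarrow> (nat \<Rightarrow> real) \<Rightarrow> (nat \<Rightarrow> real) \<Rightarrow> nat \<Rightarrow> real \<Rightarrow> real \<Rightarrow> real" where
  "interval_varextropy_estimator K h x n t1 t2 =
     interval_varextropy (empirical_cdf x n) (kernel_density_estimator K h x n) t1 t2"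

end

theory Submission
  imports Defs "HOL-Real_Asymp.Real_Asymp"
begin

text \<open>
  The kernel is only assumed to lie in \<open>L\<^sup>1 \<inter> L\<^sup>3\<close>, so uniform convergence of the estimator \<open>f\<^sub>n\<close> is not
  available. Instead, \<open>\<Phi>\<^sub>n = (\<integral>\<bar>f\<^sub>n - f\<bar>\<^sup>3)\<^bsup>1/3\<^esup>\<close> over \<open>[t1, t2]\<close> tends to \<open>0\<close> almost surely, which
  gives convergence of the integrals of \<open>f\<^sub>n\<^sup>2\<close> and \<open>f\<^sub>n\<^sup>3\<close>. By Minkowski's inequality, replacing one sample
  point changes \<open>\<Phi>\<^sub>n\<close> by at most a constant times \<open>n\<^bsup>-1\<^esup> h\<^sub>n\<^bsup>-2/3\<^esup>\<close>, which is at most a constant times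
  \<open>n\<^bsup>-2/3\<^esup>\<close> since eventually \<open>h\<^sub>n \<ge> n\<^bsup>-1/2\<^esup>\<close>. McDiarmid's inequality then yields tails of the form
  \<open>exp (-c n\<^bsup>1/3\<^esup>)\<close>, so \<open>\<Phi>\<^sub>n - E \<Phi>\<^sub>n\<close> tends to \<open>0\<close> almost surely by Borel-Cantelli. Finally \<open>E \<Phi>\<^sub>n\<close> tends
  to \<open>0\<close>: the bias is of order \<open>h\<^sub>n\<close> by the Lipschitz continuity of \<open>f\<close>, and the pointwise third absolute
  moment of the random part is controlled by second and third central moments, which are additive over
  independent summands. The empirical distribution function is handled by the same concentration
  inequality.
\<close>

section \<open>McDiarmid's inequality\<close>

text \<open>Induction on \<open>I\<close>, integrating out one coordinate at a time. With the other
  coordinates fixed, Hoeffding's lemma contributes one factor, and the averaged function inherits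
  the remaining bounded differences. Boundedness is carried along because it yields the
  integrability of \<open>\<phi>\<close> that splitting its mean by Fubini requires.\<close>

lemma (in product_sigma_finite) bounded_differences_mgf:
  fixes \<phi> :: "('i \<Rightarrow> 'a) \<Rightarrow> real" and c :: "'i \<Rightarrow> real"
  assumes prob: "\<And>i. prob_space (M i)"
    and l: "l > 0"
    and I: "finite I"
    and "\<phi> \<in> borel_measurable (Pi\<^sub>M I M)"
    and "\<And>x i y. x \<in> space (Pi\<^sub>M I M) \<Longrightarrow> i \<in> I \<Longrightarrow> y \<in> space (M i) \<Longrightarrow> \<bar>\<phi> x - \<phi> (x(i := y))\<bar> \<le> c i"
  shows "(\<exists>B. \<forall>x\<in>space (Pi\<^sub>M I M). \<bar>\<phi> x\<bar> \<le> B) \<and>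
    (\<integral>\<^sup>+x. ennreal (exp (l * \<phi> x)) \<partial>Pi\<^sub>M I M)
      \<le> ennreal (exp (l * (\<integral>x. \<phi> x \<partial>Pi\<^sub>M I M) + l\<^sup>2 / 2 * (\<Sum>i\<in>I. (c i)\<^sup>2)))"
  using I assms(4-5)
proof (induction I arbitrary: \<phi> rule: finite_induct)
  case empty
  show ?case
    by (auto simp: PiM_empty nn_integral_count_space_finite lebesgue_integral_count_space_finite)
next
  case (insert i I)
  interpret Mi: prob_space "M i" by (rule prob)
  interpret PI: prob_space "Pi\<^sub>M I M" by (intro prob_space_PiM prob)
  interpret PJ: prob_space "Pi\<^sub>M (insert i I) M" by (intro prob_space_PiM prob)
  note [measurable] = insert.prems(1)
  obtain y0 where y0: "y0 \<in> space (M i)" using Mi.not_empty by blast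
  have upd: "x(i := y) \<in> space (Pi\<^sub>M (insert i I) M)" if "x \<in> space (Pi\<^sub>M I M)" "y \<in> space (M i)" for x y
    using that by (auto simp: space_PiM PiE_def extensional_def)
  have diff: "\<bar>\<phi> (x(i := y)) - \<phi> (x(i := z))\<bar> \<le> c i"
    if "x \<in> space (Pi\<^sub>M I M)" "y \<in> space (M i)" "z \<in> space (M i)" for x y z
    using insert.prems(2)[OF upd[OF that(1,2)], of i z] that by (simp del: fun_upd_apply)
  have upd_meas[measurable]: "(\<lambda>y. \<phi> (x(i := y))) \<in> borel_measurable (M i)" if "x \<in> space (Pi\<^sub>M I M)" for x
    using measurable_comp[OF measurable_component_update insert.prems(1), OF that insert.hyps(2)]
    unfolding comp_def .
  \<comment> \<open>The reference point \<open>y0\<close> centres an interval of length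
    \<open>2 * c i\<close>; Hoeffding's exponent \<open>l^2 * (2 * c i)^2 / 8\<close> is then
    \<open>l^2 / 2 * (c i)^2\<close>.\<close>
  have rv: "interval_bounded_random_variable (M i) (\<lambda>y. \<phi> (x(i := y))) (\<phi> (x(i := y0)) - c i) (\<phi> (x(i := y0)) + c i)"
    if "x \<in> space (Pi\<^sub>M I M)" for x
  proof unfold_locales
    show "AE y in M i. \<phi> (x(i := y)) \<in> {\<phi> (x(i := y0)) - c i..\<phi> (x(i := y0)) + c i}"
      using diff[OF that _ y0] by (auto simp: abs_le_iff algebra_simps intro!: AE_I2)
  qed (rule upd_meas[OF that])
  have int: "integrable (M i) (\<lambda>y. \<phi> (x(i := y)))" if "x \<in> space (Pi\<^sub>M I M)" for x
    by (rule interval_bounded_random_variable.integrable[OF rv[OF that]])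
  \<comment> \<open>This is the conditional mean of \<open>\<phi>\<close> given the coordinates in
    \<open>I\<close>.\<close>
  define \<psi> where "\<psi> x = (\<integral>y. \<phi> (x(i := y)) \<partial>M i)" for x
  have [measurable]: "\<psi> \<in> borel_measurable (Pi\<^sub>M I M)"
    unfolding \<psi>_def
    by (rule sigma_finite_measure.borel_measurable_lebesgue_integral[OF prob_space_imp_sigma_finite[OF prob]])
       (use measurable_comp[OF measurable_add_dim insert.prems(1)] in \<open>simp add: comp_def case_prod_beta\<close>)
  have \<psi>_diff: "\<bar>\<psi> x - \<psi> (x(j := y))\<bar> \<le> c j"
    if x: "x \<in> space (Pi\<^sub>M I M)" and j: "j \<in> I" and y: "y \<in> space (M j)" for x j y
  proof -
    have x': "x(j := y) \<in> space (Pi\<^sub>M I M)"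
      using that by (auto simp: space_PiM PiE_def extensional_def)
    have "\<psi> x - \<psi> (x(j := y)) = (\<integral>z. \<phi> (x(i := z)) - \<phi> (x(j := y, i := z)) \<partial>M i)"
      unfolding \<psi>_def by (rule Bochner_Integration.integral_diff[symmetric, OF int[OF x] int[OF x']])
    also have "\<bar>\<dots>\<bar> \<le> (\<integral>z. \<bar>\<phi> (x(i := z)) - \<phi> (x(j := y, i := z))\<bar> \<partial>M i)"
      by (rule integral_abs_bound)
    also have "\<dots> \<le> (\<integral>z. c j \<partial>M i)"
    proof (rule integral_mono)
      show "integrable (M i) (\<lambda>z. \<bar>\<phi> (x(i := z)) - \<phi> (x(j := y, i := z))\<bar>)"
        using int[OF x] int[OF x'] by auto
      fix z assume z: "z \<in> space (M i)"
      have "j \<noteq> i" using j insert.hyps by auto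
      then show "\<bar>\<phi> (x(i := z)) - \<phi> (x(j := y, i := z))\<bar> \<le> c j"
        using insert.prems(2)[OF upd[OF x z], of j y] j y by (simp add: fun_upd_twist del: fun_upd_apply)
    qed auto
    finally show ?thesis by (simp add: Mi.prob_space)
  qed
  from insert.IH[of \<psi>, OF \<open>\<psi> \<in> _\<close> \<psi>_diff]
  obtain B where B: "\<And>x. x \<in> space (Pi\<^sub>M I M) \<Longrightarrow> \<bar>\<psi> x\<bar> \<le> B"
    and mgf: "(\<integral>\<^sup>+x. ennreal (exp (l * \<psi> x)) \<partial>Pi\<^sub>M I M)
      \<le> ennreal (exp (l * (\<integral>x. \<psi> x \<partial>Pi\<^sub>M I M) + l\<^sup>2 / 2 * (\<Sum>i\<in>I. (c i)\<^sup>2)))"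
    by blast
  \<comment> \<open>A function stays as close to its average as its values stay to each other. This
    transfers the bound on \<open>\<psi>\<close> to \<open>\<phi>\<close>.\<close>
  have near: "\<bar>\<phi> (x(i := y)) - \<psi> x\<bar> \<le> c i" if x: "x \<in> space (Pi\<^sub>M I M)" and y: "y \<in> space (M i)" for x y
  proof -
    have "\<phi> (x(i := y)) - \<psi> x = (\<integral>z. \<phi> (x(i := y)) - \<phi> (x(i := z)) \<partial>M i)"
      unfolding \<psi>_def using int[OF x] by (simp add: Mi.prob_space)
    also have "\<bar>\<dots>\<bar> \<le> (\<integral>z. \<bar>\<phi> (x(i := y)) - \<phi> (x(i := z))\<bar> \<partial>M i)"
      by (rule integral_abs_bound)
    also have "\<dots> \<le> (\<integral>z. c i \<partial>M i)"
      using int[OF x] diff[OF x y] by (intro integral_mono) auto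
    finally show ?thesis by (simp add: Mi.prob_space)
  qed
  have bound: "\<bar>\<phi> x\<bar> \<le> B + c i" if x: "x \<in> space (Pi\<^sub>M (insert i I) M)" for x
  proof -
    have r: "restrict x I \<in> space (Pi\<^sub>M I M)" "x i \<in> space (M i)"
      using x by (auto simp: space_PiM PiE_def)
    have "(restrict x I)(i := x i) = x"
      using x by (auto simp: space_PiM PiE_def extensional_def fun_eq_iff)
    with near[OF r] B[OF r(1)] show ?thesis by simp
  qed
  have int\<phi>: "integrable (Pi\<^sub>M (insert i I) M) \<phi>"
    using bound by (intro PJ.integrable_const_bound[where B = "B + c i"]) auto
  have mean: "(\<integral>x. \<phi> x \<partial>Pi\<^sub>M (insert i I) M) = (\<integral>x. \<psi> x \<partial>Pi\<^sub>M I M)"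
    unfolding \<psi>_def using insert.hyps int\<phi> by (rule product_integral_insert)
  have "(\<integral>\<^sup>+x. ennreal (exp (l * \<phi> x)) \<partial>Pi\<^sub>M (insert i I) M)
      = (\<integral>\<^sup>+x. (\<integral>\<^sup>+y. ennreal (exp (l * \<phi> (x(i := y)))) \<partial>M i) \<partial>Pi\<^sub>M I M)"
    using insert.hyps by (intro product_nn_integral_insert) auto
  \<comment> \<open>For fixed \<open>x\<close>, the inner integral is the moment generating function
    of the section centred at \<open>\<psi> x\<close>, times
    \<open>exp (l * \<psi> x)\<close>.\<close>
  also have "\<dots> \<le> (\<integral>\<^sup>+x. ennreal (exp (l\<^sup>2 / 2 * (c i)\<^sup>2)) * ennreal (exp (l * \<psi> x)) \<partial>Pi\<^sub>M I M)"
  proof (intro nn_integral_mono)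
    fix x assume x: "x \<in> space (Pi\<^sub>M I M)"
    have "(\<integral>\<^sup>+y. ennreal (exp (l * \<phi> (x(i := y)))) \<partial>M i)
        = (\<integral>\<^sup>+y. ennreal (exp (l * (\<phi> (x(i := y)) - \<psi> x))) * ennreal (exp (l * \<psi> x)) \<partial>M i)"
      by (intro nn_integral_cong) (simp add: exp_diff right_diff_distrib flip: ennreal_mult)
    also have "\<dots> = (\<integral>\<^sup>+y. ennreal (exp (l * (\<phi> (x(i := y)) - \<psi> x))) \<partial>M i) * ennreal (exp (l * \<psi> x))"
      using upd_meas[OF x] by (intro nn_integral_multc) (simp del: fun_upd_apply)
    also have "\<dots> \<le> ennreal (exp (l\<^sup>2 / 2 * (c i)\<^sup>2)) * ennreal (exp (l * \<psi> x))"
      using interval_bounded_random_variable.Hoeffdings_lemma_nn_integral[OF rv[OF x] l]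
      by (intro mult_right_mono) (simp_all add: \<psi>_def power_mult_distrib)
    finally show "(\<integral>\<^sup>+y. ennreal (exp (l * \<phi> (x(i := y)))) \<partial>M i)
        \<le> ennreal (exp (l\<^sup>2 / 2 * (c i)\<^sup>2)) * ennreal (exp (l * \<psi> x))" .
  qed
  also have "\<dots> = ennreal (exp (l\<^sup>2 / 2 * (c i)\<^sup>2)) * (\<integral>\<^sup>+x. ennreal (exp (l * \<psi> x)) \<partial>Pi\<^sub>M I M)"
    by (rule nn_integral_cmult) measurable
  also have "\<dots> \<le> ennreal (exp (l\<^sup>2 / 2 * (c i)\<^sup>2)) *
      ennreal (exp (l * (\<integral>x. \<psi> x \<partial>Pi\<^sub>M I M) + l\<^sup>2 / 2 * (\<Sum>i\<in>I. (c i)\<^sup>2)))"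
    by (intro mult_left_mono mgf) simp
  also have "\<dots> = ennreal (exp (l * (\<integral>x. \<phi> x \<partial>Pi\<^sub>M (insert i I) M) + l\<^sup>2 / 2 * (\<Sum>i\<in>insert i I. (c i)\<^sup>2)))"
    using insert.hyps by (simp add: mean algebra_simps flip: ennreal_mult exp_add)
  finally have "(\<integral>\<^sup>+x. ennreal (exp (l * \<phi> x)) \<partial>Pi\<^sub>M (insert i I) M)
    \<le> ennreal (exp (l * (\<integral>x. \<phi> x \<partial>Pi\<^sub>M (insert i I) M) + l\<^sup>2 / 2 * (\<Sum>i\<in>insert i I. (c i)\<^sup>2)))" .
  with bound show ?case by (intro conjI exI[of _ "B + c i"]) auto
qed

text \<open>Chernoff's bound applied to \<open>bounded_differences_mgf\<close>. By independence the
  joint law of the sample is a product measure, so the integral over \<open>M\<close> becomes one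
  over \<open>Pi\<^sub>M I N\<close>.\<close>

lemma (in prob_space) bounded_differences_upper_tail:
  fixes X :: "'i \<Rightarrow> 'a \<Rightarrow> real" and \<phi> :: "('i \<Rightarrow> real) \<Rightarrow> real"
  assumes I: "finite I" "I \<noteq> {}"
    and indep: "indep_vars (\<lambda>_. borel) X I"
    and \<phi>[measurable]: "\<phi> \<in> borel_measurable (Pi\<^sub>M I (\<lambda>_. borel))"
    and diff: "\<And>x i y. i \<in> I \<Longrightarrow> \<bar>\<phi> x - \<phi> (x(i := y))\<bar> \<le> c i"
    and D: "(\<Sum>i\<in>I. (c i)\<^sup>2) \<le> D" "D > 0" and \<epsilon>: "\<epsilon> > 0"
  shows "prob {\<omega>\<in>space M. \<phi> (\<lambda>i\<in>I. X i \<omega>) - expectation (\<lambda>\<omega>. \<phi> (\<lambda>i\<in>I. X i \<omega>)) \<ge> \<epsilon>} \<le> exp (- \<epsilon>\<^sup>2 / (2 * D))"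
proof -
  have rv[measurable]: "random_variable borel (X i)" if "i \<in> I" for i
    using indep that by (auto simp: indep_vars_def)
  text \<open>The product locale asks for a probability measure at every index, also outside \<open>I\<close>.\<close>
  define N where "N i = (if i \<in> I then distr M borel (X i) else return borel 0)" for i
  have N: "prob_space (N i)" for i
    by (auto simp: N_def intro!: prob_space_distr rv prob_space_return)
  have setsN[measurable_cong]: "sets (N i) = sets borel" for i by (simp add: N_def)
  interpret product_sigma_finite N
    by (simp add: product_sigma_finite_def N prob_space_imp_sigma_finite)
  have sets_eq: "sets (Pi\<^sub>M I N) = sets (Pi\<^sub>M I (\<lambda>_. borel))"
    by (intro sets_PiM_cong setsN refl)
  have \<phi>N: "\<phi> \<in> borel_measurable (Pi\<^sub>M I N)"
    using \<phi> by (simp add: measurable_cong_sets[OF sets_eq refl])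
  have R[measurable]: "(\<lambda>\<omega>. \<lambda>i\<in>I. X i \<omega>) \<in> measurable M (Pi\<^sub>M I (\<lambda>_. borel))"
    by (intro measurable_restrict rv)
  have "distr M (Pi\<^sub>M I (\<lambda>_. borel)) (\<lambda>\<omega>. \<lambda>i\<in>I. X i \<omega>) = Pi\<^sub>M I (\<lambda>i. distr M borel (X i))"
    using indep indep_vars_iff_distr_eq_PiM'[OF I(2), where X = X and M' = "\<lambda>_. borel"] rv by blast
  also have "\<dots> = Pi\<^sub>M I N" by (intro PiM_cong) (auto simp: N_def)
  finally have distr: "distr M (Pi\<^sub>M I (\<lambda>_. borel)) (\<lambda>\<omega>. \<lambda>i\<in>I. X i \<omega>) = Pi\<^sub>M I N" .
  define m where "m = expectation (\<lambda>\<omega>. \<phi> (\<lambda>i\<in>I. X i \<omega>))"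
  have m: "(\<integral>x. \<phi> x \<partial>Pi\<^sub>M I N) = m"
    unfolding distr[symmetric] m_def by (intro integral_distr) auto
  \<comment> \<open>This choice minimises the exponent
    \<open>l^2 / 2 * D - l * \<epsilon>\<close>.\<close>
  define l where "l = \<epsilon> / D"
  have l: "l > 0" using \<epsilon> D by (simp add: l_def)
  have mgf: "(\<integral>\<^sup>+x. ennreal (exp (l * \<phi> x)) \<partial>Pi\<^sub>M I N) \<le> ennreal (exp (l * m + l\<^sup>2 / 2 * (\<Sum>i\<in>I. (c i)\<^sup>2)))"
    unfolding m[symmetric] by (rule bounded_differences_mgf[OF N l I(1) \<phi>N diff, THEN conjunct2])
  have "ennreal (prob {\<omega>\<in>space M. \<phi> (\<lambda>i\<in>I. X i \<omega>) - m \<ge> \<epsilon>})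
      = emeasure M {\<omega>\<in>space M. \<phi> (\<lambda>i\<in>I. X i \<omega>) - m \<ge> \<epsilon>}"
    by (simp add: emeasure_eq_measure)
  also have "\<dots> \<le> ennreal (exp (- l * \<epsilon>)) * (\<integral>\<^sup>+\<omega>\<in>space M. exp (l * (\<phi> (\<lambda>i\<in>I. X i \<omega>) - m)) \<partial>M)"
    by (intro Chernoff_ineq_nn_integral_ge l) auto
  also have "(\<integral>\<^sup>+\<omega>\<in>space M. exp (l * (\<phi> (\<lambda>i\<in>I. X i \<omega>) - m)) \<partial>M)
      = (\<integral>\<^sup>+\<omega>. ennreal (exp (- l * m)) * ennreal (exp (l * \<phi> (\<lambda>i\<in>I. X i \<omega>))) \<partial>M)"
    by (intro nn_integral_cong) (simp add: algebra_simps flip: ennreal_mult exp_add)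
  also have "\<dots> = ennreal (exp (- l * m)) * (\<integral>\<^sup>+\<omega>. ennreal (exp (l * \<phi> (\<lambda>i\<in>I. X i \<omega>))) \<partial>M)"
    by (intro nn_integral_cmult) measurable
  also have "(\<integral>\<^sup>+\<omega>. ennreal (exp (l * \<phi> (\<lambda>i\<in>I. X i \<omega>))) \<partial>M) = (\<integral>\<^sup>+x. ennreal (exp (l * \<phi> x)) \<partial>Pi\<^sub>M I N)"
    unfolding distr[symmetric] by (subst nn_integral_distr) auto
  also have "ennreal (exp (- l * \<epsilon>)) * (ennreal (exp (- l * m)) * \<dots>)
      \<le> ennreal (exp (- l * \<epsilon>)) * (ennreal (exp (- l * m)) * ennreal (exp (l * m + l\<^sup>2 / 2 * D)))"
    using D by (intro mult_left_mono order.trans[OF mgf] ennreal_leI) (auto intro!: mult_left_mono)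
  also have "\<dots> = ennreal (exp (l\<^sup>2 / 2 * D - l * \<epsilon>))"
    by (simp add: algebra_simps flip: ennreal_mult exp_add)
  also have "l\<^sup>2 / 2 * D - l * \<epsilon> = - \<epsilon>\<^sup>2 / (2 * D)"
    using D by (simp add: l_def field_simps power2_eq_square)
  finally have "prob {\<omega>\<in>space M. \<phi> (\<lambda>i\<in>I. X i \<omega>) - m \<ge> \<epsilon>} \<le> exp (- \<epsilon>\<^sup>2 / (2 * D))"
    by (subst (asm) ennreal_le_iff) auto
  then show "prob {\<omega>\<in>space M. \<phi> (\<lambda>i\<in>I. X i \<omega>) - expectation (\<lambda>\<omega>. \<phi> (\<lambda>i\<in>I. X i \<omega>)) \<ge> \<epsilon>} \<le> exp (- \<epsilon>\<^sup>2 / (2 * D))"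
    unfolding m_def .
qed

section \<open>Almost sure convergence from bounded differences\<close>

lemma summable_exp_neg_cube_root:
  fixes a :: real
  assumes "a > 0"
  shows "summable (\<lambda>n. exp (- a * real n powr (1/3)))"
proof (rule summable_comparison_test_bigo)
  show "summable (\<lambda>n. norm (1 / real n ^ 2))"
    using inverse_power_summable[of 2, where 'a = real] by (simp add: divide_inverse)
  show "(\<lambda>n. exp (- a * real n powr (1/3))) \<in> O(\<lambda>n. 1 / real n ^ 2)"
    using assms by real_asymp
qed

text \<open>The squared differences sum to at most a constant times
  \<open>n * n powr (- 4 / 3) = n powr (- 1 / 3)\<close>, so the tails decay like
  \<open>exp (- a * n powr (1/3))\<close>. These are summable, and Borel-Cantelli applies.\<close>

lemma (in prob_space) bounded_differences_AE_tendsto: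
  fixes X :: "nat \<Rightarrow> 'a \<Rightarrow> real" and \<phi> :: "nat \<Rightarrow> (nat \<Rightarrow> real) \<Rightarrow> real"
  assumes indep: "indep_vars (\<lambda>_. borel) X {1..}"
    and \<phi>: "\<And>n. \<phi> n \<in> borel_measurable (Pi\<^sub>M {1..n} (\<lambda>_. borel))"
    and diff: "\<And>n x i y. i \<in> {1..n} \<Longrightarrow> \<bar>\<phi> n x - \<phi> n (x(i := y))\<bar> \<le> c n"
    and c: "\<forall>\<^sub>F n in sequentially. c n \<le> C * real n powr (- 2 / 3)"
  shows "AE \<omega> in M. (\<lambda>n. \<phi> n (\<lambda>i\<in>{1..n}. X i \<omega>) - expectation (\<lambda>\<omega>. \<phi> n (\<lambda>i\<in>{1..n}. X i \<omega>))) \<longlonglongrightarrow> 0"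
proof -
  define Y where "Y n \<omega> = \<phi> n (\<lambda>i\<in>{1..n}. X i \<omega>)" for n \<omega>
  have rv: "random_variable borel (X i)" if "i \<ge> 1" for i
    using indep that by (auto simp: indep_vars_def)
  have [measurable]: "Y n \<in> borel_measurable M" for n
    unfolding Y_def by (rule measurable_compose[OF _ \<phi>]) (auto intro!: measurable_restrict rv)
  \<comment> \<open>The maximum keeps the variance proxy strictly positive for every real
    \<open>C\<close>.\<close>
  define E where "E = max 1 C"
  have tail: "\<forall>\<^sub>F n in sequentially.
      prob {\<omega>\<in>space M. \<bar>Y n \<omega> - expectation (Y n)\<bar> \<ge> \<epsilon>} \<le> 2 * exp (- (\<epsilon>\<^sup>2 / (2 * E\<^sup>2)) * real n powr (1/3))"
    if \<epsilon>: "\<epsilon> > 0" for \<epsilon>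
    using c eventually_gt_at_top[of 0]
  proof eventually_elim
    case (elim n)
    have ind: "indep_vars (\<lambda>_. borel) X {1..n}"
      by (rule indep_vars_subset[OF indep]) auto
    \<comment> \<open>Squaring the upper bound on \<open>c n\<close> requires its sign, which the
      bounded difference at any sample and the index \<open>1\<close> supplies.\<close>
    have "0 \<le> c n"
      using diff[of 1 n "\<lambda>_. 0" 0] elim by auto
    have "c n \<le> E * real n powr (- 2 / 3)"
      using elim(1) by (rule order.trans) (auto simp: E_def intro!: mult_right_mono)
    with \<open>0 \<le> c n\<close> have "(c n)\<^sup>2 \<le> (E * real n powr (- 2 / 3))\<^sup>2"
      by (intro power_mono)
    then have "(\<Sum>i\<in>{1..n}. (c n)\<^sup>2) \<le> real n * (E * real n powr (- 2 / 3))\<^sup>2"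
      by (simp add: mult_left_mono)
    also have "\<dots> = E\<^sup>2 * (real n powr 1 * (real n powr (- 2 / 3) * real n powr (- 2 / 3)))"
      using elim by (simp add: power2_eq_square algebra_simps)
    also have "\<dots> = E\<^sup>2 * real n powr (- 1 / 3)"
      by (simp only: flip: powr_add) simp
    finally have D: "(\<Sum>i\<in>{1..n}. (c n)\<^sup>2) \<le> E\<^sup>2 * real n powr (- 1 / 3)" .
    have D0: "E\<^sup>2 * real n powr (- 1 / 3) > 0" using elim by (simp add: E_def)
    have n: "finite {1..n}" "{1..n} \<noteq> {}" using elim by auto
    have eq: "- \<epsilon>\<^sup>2 / (2 * (E\<^sup>2 * real n powr (- 1 / 3))) = - (\<epsilon>\<^sup>2 / (2 * E\<^sup>2)) * real n powr (1/3)"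
    proof -
      have "real n powr (- 1 / 3) = inverse (real n powr (1/3))" by (metis minus_divide_left powr_minus)
      moreover have "- \<epsilon>\<^sup>2 / (2 * (E\<^sup>2 * inverse P)) = - (\<epsilon>\<^sup>2 / (2 * E\<^sup>2)) * P" for P :: real
        by (cases "P = 0") (simp_all add: field_simps)
      ultimately show ?thesis by presburger
    qed
    let ?U = "{\<omega>\<in>space M. Y n \<omega> - expectation (Y n) \<ge> \<epsilon>}"
    \<comment> \<open>The lower tail of \<open>\<phi> n\<close> is the upper tail of its negation,
      which has the same bounded differences.\<close>
    let ?L = "{\<omega>\<in>space M. - Y n \<omega> - expectation (\<lambda>\<omega>. - Y n \<omega>) \<ge> \<epsilon>}"
    have "{\<omega>\<in>space M. \<bar>Y n \<omega> - expectation (Y n)\<bar> \<ge> \<epsilon>} \<subseteq> ?U \<union> ?L"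
      by auto
    then have "prob {\<omega>\<in>space M. \<bar>Y n \<omega> - expectation (Y n)\<bar> \<ge> \<epsilon>} \<le> prob (?U \<union> ?L)"
      by (rule finite_measure_mono) measurable
    also have "\<dots> \<le> prob ?U + prob ?L"
      by (rule measure_Un_le) measurable
    also have "prob {\<omega>\<in>space M. Y n \<omega> - expectation (Y n) \<ge> \<epsilon>} \<le> exp (- (\<epsilon>\<^sup>2 / (2 * E\<^sup>2)) * real n powr (1/3))"
      using bounded_differences_upper_tail[OF n ind \<phi>[of n] diff[of _ n] D D0 \<epsilon>] unfolding Y_def eq .
    also have "prob {\<omega>\<in>space M. - Y n \<omega> - expectation (\<lambda>\<omega>. - Y n \<omega>) \<ge> \<epsilon>} \<le> exp (- (\<epsilon>\<^sup>2 / (2 * E\<^sup>2)) * real n powr (1/3))"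
      using bounded_differences_upper_tail[OF n ind borel_measurable_uminus[OF \<phi>[of n]] _ D D0 \<epsilon>] diff[of _ n]
      unfolding Y_def eq by (simp add: abs_minus_commute del: restrict_apply)
    finally show ?case by simp
  qed
  \<comment> \<open>Countably many thresholds suffice for convergence, so the exceptional null sets
    can be united afterwards.\<close>
  have "AE \<omega> in M. \<forall>\<^sub>F n in sequentially. \<bar>Y n \<omega> - expectation (Y n)\<bar> < 1 / real (Suc k)" for k
  proof -
    let ?A = "\<lambda>n. {\<omega>\<in>space M. \<bar>Y n \<omega> - expectation (Y n)\<bar> \<ge> 1 / real (Suc k)}"
    have "summable (\<lambda>n. 2 * exp (- ((1 / real (Suc k))\<^sup>2 / (2 * E\<^sup>2)) * real n powr (1/3)))"
      by (intro summable_mult summable_exp_neg_cube_root) (auto simp: E_def)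
    then have "summable (\<lambda>n. prob (?A n))"
      by (rule summable_comparison_test_ev[rotated]) (use tail[of "1 / real (Suc k)"] in simp)
    then have "AE \<omega> in M. \<forall>\<^sub>F n in sequentially. \<omega> \<in> space M - ?A n"
      by (intro borel_cantelli_AE1) (auto simp: emeasure_eq_measure)
    then show ?thesis
      by (rule AE_mp) (auto elim!: eventually_mono intro!: AE_I2)
  qed
  then have "AE \<omega> in M. \<forall>k. \<forall>\<^sub>F n in sequentially. \<bar>Y n \<omega> - expectation (Y n)\<bar> < 1 / real (Suc k)"
    by (simp add: AE_all_countable)
  then show ?thesis
  proof (rule AE_mp, intro AE_I2 impI)
    fix \<omega> assume *: "\<forall>k. \<forall>\<^sub>F n in sequentially. \<bar>Y n \<omega> - expectation (Y n)\<bar> < 1 / real (Suc k)"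
    have "(\<lambda>n. Y n \<omega> - expectation (Y n)) \<longlonglongrightarrow> 0"
    proof (rule tendstoI)
      fix e :: real assume "e > 0"
      then obtain k where "1 / real (Suc k) < e"
        using nat_approx_posE by blast
      with *[rule_format, of k] show "\<forall>\<^sub>F n in sequentially. dist (Y n \<omega> - expectation (Y n)) 0 < e"
        by (auto elim: eventually_mono)
    qed
    then show "(\<lambda>n. \<phi> n (\<lambda>i\<in>{1..n}. X i \<omega>) - expectation (\<lambda>\<omega>. \<phi> n (\<lambda>i\<in>{1..n}. X i \<omega>))) \<longlonglongrightarrow> 0"
      unfolding Y_def .
  qed
qed

section \<open>The \<open>L\<^sup>3\<close> norm and third moments\<close>

text \<open>Convexity of the cube at \<open>x / a\<close> and \<open>y / b\<close> with weights
  \<open>a / (a + b)\<close> and \<open>b / (a + b)\<close>. Free weights make Minkowski's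
  inequality a pointwise estimate followed by integration.\<close>

lemma add_cube_le:
  fixes x y a b :: real
  assumes "0 \<le> x" "0 \<le> y" "0 < a" "0 < b"
  shows "(x + y) ^ 3 \<le> (a + b)\<^sup>2 * (x ^ 3 / a\<^sup>2 + y ^ 3 / b\<^sup>2)"
proof -
  define s where "s = b / (a + b)"
  have s: "0 \<le> s" "s \<le> 1" "1 - s = a / (a + b)"
    using assms by (auto simp: s_def field_simps)
  have "((1 - s) *\<^sub>R (x / a) + s *\<^sub>R (y / b)) ^ 3 \<le> (1 - s) * (x / a) ^ 3 + s * (y / b) ^ 3"
    using s assms by (intro convex_onD[OF convex_power_odd[of 3]]) auto
  also have "(1 - s) *\<^sub>R (x / a) + s *\<^sub>R (y / b) = (x + y) / (a + b)"
    using assms unfolding s(3) by (simp add: s_def add_divide_distrib)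
  also have "(1 - s) * (x / a) ^ 3 + s * (y / b) ^ 3 = (x ^ 3 / a\<^sup>2 + y ^ 3 / b\<^sup>2) / (a + b)"
    using assms unfolding s(3) by (simp add: s_def add_divide_distrib power3_eq_cube power2_eq_square mult_ac)
  finally have "(x + y) ^ 3 / (a + b) ^ 3 \<le> (x ^ 3 / a\<^sup>2 + y ^ 3 / b\<^sup>2) / (a + b)"
    by (simp add: power_divide)
  then have "(x + y) ^ 3 \<le> (x ^ 3 / a\<^sup>2 + y ^ 3 / b\<^sup>2) / (a + b) * (a + b) ^ 3"
    using assms by (simp add: pos_divide_le_eq)
  also have "\<dots> = (a + b)\<^sup>2 * (x ^ 3 / a\<^sup>2 + y ^ 3 / b\<^sup>2)"
    using assms by (simp add: power3_eq_cube power2_eq_square)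
  finally show ?thesis .
qed

lemma abs_add_cube_le:
  fixes x y a b :: real
  assumes "0 < a" "0 < b"
  shows "\<bar>x + y\<bar> ^ 3 \<le> (a + b)\<^sup>2 * (\<bar>x\<bar> ^ 3 / a\<^sup>2 + \<bar>y\<bar> ^ 3 / b\<^sup>2)"
proof -
  have "\<bar>x + y\<bar> ^ 3 \<le> (\<bar>x\<bar> + \<bar>y\<bar>) ^ 3"
    by (intro power_mono) auto
  also have "\<dots> \<le> (a + b)\<^sup>2 * (\<bar>x\<bar> ^ 3 / a\<^sup>2 + \<bar>y\<bar> ^ 3 / b\<^sup>2)"
    using assms by (intro add_cube_le) auto
  finally show ?thesis .
qed

lemma integrable_abs_cube_add:
  fixes f g :: "'a \<Rightarrow> real"
  assumes [measurable]: "f \<in> borel_measurable M" "g \<in> borel_measurable M"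
    and "integrable M (\<lambda>x. \<bar>f x\<bar> ^ 3)" "integrable M (\<lambda>x. \<bar>g x\<bar> ^ 3)"
  shows "integrable M (\<lambda>x. \<bar>f x + g x\<bar> ^ 3)"
proof (rule Bochner_Integration.integrable_bound)
  show "integrable M (\<lambda>x. 4 * (\<bar>f x\<bar> ^ 3 + \<bar>g x\<bar> ^ 3))"
    using assms(3,4) by simp
  show "AE x in M. norm (\<bar>f x + g x\<bar> ^ 3) \<le> norm (4 * (\<bar>f x\<bar> ^ 3 + \<bar>g x\<bar> ^ 3))"
    using abs_add_cube_le[of 1 1] by (intro AE_I2) simp
qed measurable

lemma integrable_abs_cube_diff:
  fixes f g :: "'a \<Rightarrow> real"
  assumes "f \<in> borel_measurable M" "g \<in> borel_measurable M"
    and "integrable M (\<lambda>x. \<bar>f x\<bar> ^ 3)" "integrable M (\<lambda>x. \<bar>g x\<bar> ^ 3)"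
  shows "integrable M (\<lambda>x. \<bar>f x - g x\<bar> ^ 3)"
  using integrable_abs_cube_add[of f M "\<lambda>x. - g x"] assms by simp

lemma integrable_abs_cube_sum:
  fixes f :: "'i \<Rightarrow> 'a \<Rightarrow> real"
  assumes "finite I" "\<And>i. i \<in> I \<Longrightarrow> f i \<in> borel_measurable M"
    and "\<And>i. i \<in> I \<Longrightarrow> integrable M (\<lambda>x. \<bar>f i x\<bar> ^ 3)"
  shows "integrable M (\<lambda>x. \<bar>\<Sum>i\<in>I. f i x\<bar> ^ 3)"
  using assms by (induction I rule: finite_induct) (auto intro!: integrable_abs_cube_add)

text \<open>Powers up to the third are dominated by \<open>1 + \<bar>f x\<bar> ^ 3\<close>, and
  constants are integrable on a finite measure space.\<close>

lemma (in finite_measure) integrable_power_of_abs_cube: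
  fixes f :: "'a \<Rightarrow> real"
  assumes [measurable]: "f \<in> borel_measurable M" and "integrable M (\<lambda>x. \<bar>f x\<bar> ^ 3)" and "k \<le> 3"
  shows "integrable M (\<lambda>x. f x ^ k)"
proof (rule Bochner_Integration.integrable_bound)
  show "integrable M (\<lambda>x. 1 + \<bar>f x\<bar> ^ 3)" using assms(2) by simp
  have "y ^ k \<le> 1 + y ^ 3" if "y \<ge> 0" for y :: real
  proof (cases "y \<le> 1")
    case True
    then show ?thesis using power_le_one[of y k] that by (simp add: add_increasing2)
  next
    case False
    then have "y ^ k \<le> y ^ 3" using \<open>k \<le> 3\<close> by (intro power_increasing) auto
    then show ?thesis by simp
  qed
  then show "AE x in M. norm (f x ^ k) \<le> norm (1 + \<bar>f x\<bar> ^ 3)"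
    by (intro AE_I2) (simp add: power_abs)
qed measurable

text \<open>The seminorm of \<open>L^3\<close>. It takes the value \<open>0\<close> when the cube is
  not integrable, whence the integrability assumptions in the triangle inequality below.\<close>

definition cube_norm :: "'a measure \<Rightarrow> ('a \<Rightarrow> real) \<Rightarrow> real" where
  "cube_norm M f = root 3 (\<integral>x. \<bar>f x\<bar> ^ 3 \<partial>M)"

lemma cube_norm_nonneg: "0 \<le> cube_norm M f"
  by (simp add: cube_norm_def)

lemma cube_norm_power: "cube_norm M f ^ 3 = (\<integral>x. \<bar>f x\<bar> ^ 3 \<partial>M)"
  by (simp add: cube_norm_def)

lemma cube_norm_cmult: "cube_norm M (\<lambda>x. c * f x) = \<bar>c\<bar> * cube_norm M f"
  by (simp add: cube_norm_def abs_mult power_mult_distrib real_root_mult real_root_power_cancel)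

text \<open>Minkowski's inequality: \<open>abs_add_cube_le\<close> is integrated with the two norms
  as weights. Adding \<open>e / 2\<close> to each keeps the weights positive when a norm
  vanishes.\<close>

lemma cube_norm_add:
  assumes [measurable]: "f \<in> borel_measurable M" "g \<in> borel_measurable M"
    and int: "integrable M (\<lambda>x. \<bar>f x\<bar> ^ 3)" "integrable M (\<lambda>x. \<bar>g x\<bar> ^ 3)"
  shows "cube_norm M (\<lambda>x. f x + g x) \<le> cube_norm M f + cube_norm M g"
proof (rule field_le_epsilon)
  fix e :: real assume e: "e > 0"
  define a where "a = cube_norm M f + e / 2"
  define b where "b = cube_norm M g + e / 2"
  have pos: "a > 0" "b > 0" using e cube_norm_nonneg[of M f] cube_norm_nonneg[of M g]
    by (auto simp: a_def b_def)
  have a: "(\<integral>x. \<bar>f x\<bar> ^ 3 \<partial>M) \<le> a ^ 3"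
    using e by (auto simp: a_def cube_norm_nonneg simp flip: cube_norm_power intro!: power_mono)
  have b: "(\<integral>x. \<bar>g x\<bar> ^ 3 \<partial>M) \<le> b ^ 3"
    using e by (auto simp: b_def cube_norm_nonneg simp flip: cube_norm_power intro!: power_mono)
  have "(\<integral>x. \<bar>f x + g x\<bar> ^ 3 \<partial>M) \<le> (\<integral>x. (a + b)\<^sup>2 * (\<bar>f x\<bar> ^ 3 / a\<^sup>2 + \<bar>g x\<bar> ^ 3 / b\<^sup>2) \<partial>M)"
    using int pos by (intro integral_mono integrable_abs_cube_add abs_add_cube_le) auto
  also have "\<dots> = (a + b)\<^sup>2 * ((\<integral>x. \<bar>f x\<bar> ^ 3 \<partial>M) / a\<^sup>2 + (\<integral>x. \<bar>g x\<bar> ^ 3 \<partial>M) / b\<^sup>2)"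
    using int by simp
  also have "\<dots> \<le> (a + b)\<^sup>2 * (a ^ 3 / a\<^sup>2 + b ^ 3 / b\<^sup>2)"
    by (intro mult_left_mono add_mono divide_right_mono a b) auto
  also have "\<dots> = (a + b) ^ 3"
    using pos by (simp add: power3_eq_cube power2_eq_square)
  finally have "cube_norm M (\<lambda>x. f x + g x) \<le> root 3 ((a + b) ^ 3)"
    by (simp add: cube_norm_def)
  also have "\<dots> = a + b" using pos by (simp add: real_root_power_cancel)
  finally show "cube_norm M (\<lambda>x. f x + g x) \<le> cube_norm M f + cube_norm M g + e"
    by (simp add: a_def b_def)
qed

text \<open>Convergence in \<open>L^3\<close> implies convergence in \<open>L^k\<close> for smaller
  \<open>k\<close> on a finite measure space. A truncation at a small level \<open>s\<close> takes
  the place of Hoelder's inequality.\<close>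

lemma (in finite_measure) tendsto_integral_abs_power:
  fixes d :: "nat \<Rightarrow> 'a \<Rightarrow> real"
  assumes [measurable]: "\<And>n. d n \<in> borel_measurable M"
    and int: "\<And>n. integrable M (\<lambda>x. \<bar>d n x\<bar> ^ 3)"
    and lim: "(\<lambda>n. \<integral>x. \<bar>d n x\<bar> ^ 3 \<partial>M) \<longlonglongrightarrow> 0"
    and k: "0 < k" "k \<le> 3"
  shows "(\<lambda>n. \<integral>x. \<bar>d n x\<bar> ^ k \<partial>M) \<longlonglongrightarrow> 0"
proof (rule tendstoI)
  fix e :: real assume e: "e > 0"
  define T where "T = measure M (space M)"
  \<comment> \<open>The cap at \<open>1\<close> gives \<open>s ^ k \<le> s\<close>, and the second
    entry makes \<open>s * T\<close> at most \<open>e / 2\<close>; \<open>T + 1\<close> avoids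
    dividing by zero.\<close>
  define s where "s = min 1 (e / (2 * (T + 1)))"
  have T: "T \<ge> 0" by (simp add: T_def)
  have s: "0 < s" "s \<le> 1" using e T by (auto simp: s_def)
  have "s ^ k * T \<le> s * T"
    using s T k power_decreasing[of 1 k s] by (intro mult_right_mono) auto
  also have "\<dots> \<le> e / (2 * (T + 1)) * T" using T by (intro mult_right_mono) (auto simp: s_def)
  also have "\<dots> \<le> e / 2" using e T by (simp add: field_simps)
  finally have sT: "s ^ k * T \<le> e / 2" .
  \<comment> \<open>Values below \<open>s\<close> are charged to the first term; above
    \<open>s\<close>, each missing factor \<open>y\<close> costs at most a factor
    \<open>1 / s\<close>.\<close>
  have pw: "y ^ k \<le> s ^ k + y ^ 3 / s ^ (3 - k)" if "y \<ge> 0" for y :: real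
  proof (cases "y \<le> s")
    case True
    then have "y ^ k \<le> s ^ k" using that by (intro power_mono)
    with that s show ?thesis by (simp add: add_increasing2)
  next
    case False
    then have "y ^ k * s ^ (3 - k) \<le> y ^ k * y ^ (3 - k)"
      using that s by (intro mult_left_mono power_mono) auto
    also have "\<dots> = y ^ 3" using k by (simp flip: power_add)
    finally have "y ^ k \<le> y ^ 3 / s ^ (3 - k)" using s by (simp add: pos_le_divide_eq)
    with s show ?thesis by (simp add: add_increasing)
  qed
  have "\<forall>\<^sub>F n in sequentially. (\<integral>x. \<bar>d n x\<bar> ^ 3 \<partial>M) < e / 2 * s ^ (3 - k)"
    using order_tendstoD(2)[OF lim, of "e / 2 * s ^ (3 - k)"] e s by simp
  then show "\<forall>\<^sub>F n in sequentially. dist (\<integral>x. \<bar>d n x\<bar> ^ k \<partial>M) 0 < e"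
  proof eventually_elim
    case (elim n)
    have intk: "integrable M (\<lambda>x. \<bar>d n x\<bar> ^ k)"
      using integrable_power_of_abs_cube[of "\<lambda>x. \<bar>d n x\<bar>" k] int[of n] k by simp
    have "(\<integral>x. \<bar>d n x\<bar> ^ k \<partial>M) \<le> (\<integral>x. s ^ k + \<bar>d n x\<bar> ^ 3 / s ^ (3 - k) \<partial>M)"
      using int[of n] by (intro integral_mono intk pw) auto
    also have "\<dots> = s ^ k * T + (\<integral>x. \<bar>d n x\<bar> ^ 3 \<partial>M) / s ^ (3 - k)"
      using int[of n] by (simp add: T_def mult.commute)
    also have "\<dots> < e / 2 + e / 2"
      using elim s sT by (intro add_le_less_mono) (auto simp: pos_divide_less_eq)
    finally show ?case by simp
  qed
qed

text \<open>Writing \<open>g n = d n + f\<close> and expanding the power, every term of the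
  difference is a positive power of \<open>d n\<close> times a bounded factor, and
  \<open>tendsto_integral_abs_power\<close> disposes of each.\<close>

lemma (in finite_measure) tendsto_integral_power_of_cube_norm:
  fixes f :: "'a \<Rightarrow> real" and g :: "nat \<Rightarrow> 'a \<Rightarrow> real"
  assumes [measurable]: "\<And>n. g n \<in> borel_measurable M" "f \<in> borel_measurable M"
    and int: "\<And>n. integrable M (\<lambda>x. \<bar>g n x\<bar> ^ 3)"
    and B: "\<And>x. \<bar>f x\<bar> \<le> B"
    and lim: "(\<lambda>n. cube_norm M (\<lambda>x. g n x - f x)) \<longlonglongrightarrow> 0"
    and k: "k = 2 \<or> k = 3"
  shows "(\<lambda>n. \<integral>x. g n x ^ k \<partial>M) \<longlonglongrightarrow> (\<integral>x. f x ^ k \<partial>M)"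
proof -
  define d where "d n x = g n x - f x" for n x
  have [measurable]: "d n \<in> borel_measurable M" for n unfolding d_def by measurable
  have B0: "B \<ge> 0" using B[of undefined] by simp
  have intf: "integrable M (\<lambda>x. \<bar>f x\<bar> ^ 3)"
    using B by (intro integrable_const_bound[where B = "B ^ 3"]) (auto intro!: power_mono)
  have intd: "integrable M (\<lambda>x. \<bar>d n x\<bar> ^ 3)" for n
    unfolding d_def by (intro integrable_abs_cube_diff int intf) measurable
  have ik: "integrable M (\<lambda>x. \<bar>d n x\<bar> ^ j)" if "j \<le> 3" for n j
    using integrable_power_of_abs_cube[of "\<lambda>x. \<bar>d n x\<bar>" j] intd[of n] that by simp
  have "(\<lambda>n. cube_norm M (d n) ^ 3) \<longlonglongrightarrow> 0 ^ 3"
    using lim unfolding d_def by (intro tendsto_power)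
  then have d3: "(\<lambda>n. \<integral>x. \<bar>d n x\<bar> ^ 3 \<partial>M) \<longlonglongrightarrow> 0"
    by (simp add: cube_norm_power)
  have dj: "(\<lambda>n. \<integral>x. \<bar>d n x\<bar> ^ j \<partial>M) \<longlonglongrightarrow> 0" if "0 < j" "j \<le> 3" for j
    by (rule tendsto_integral_abs_power[OF _ intd d3 that]) measurable
  \<comment> \<open>One polynomial serves both exponents: its coefficients add those of
    \<open>k = 2\<close>, namely \<open>0\<close>, \<open>1\<close>, \<open>2 * B\<close>, to those
    of \<open>k = 3\<close>, namely \<open>1\<close>, \<open>3 * B\<close>,
    \<open>3 * B^2\<close>.\<close>
  have pw: "\<bar>(a + b) ^ k - b ^ k\<bar> \<le> \<bar>a\<bar> ^ 3 + (1 + 3 * B) * \<bar>a\<bar>\<^sup>2 + (2 * B + 3 * B\<^sup>2) * \<bar>a\<bar> ^ 1"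
    if "\<bar>b\<bar> \<le> B" for a b :: real
  proof -
    have 1: "\<bar>b\<bar> * \<bar>a\<bar> \<le> B * \<bar>a\<bar>" "\<bar>b\<bar> * \<bar>a\<bar>\<^sup>2 \<le> B * \<bar>a\<bar>\<^sup>2" "\<bar>b\<bar>\<^sup>2 * \<bar>a\<bar> \<le> B\<^sup>2 * \<bar>a\<bar>"
      by (rule mult_right_mono[OF that] mult_right_mono[OF power_mono[OF that]]; simp)+
    have nn: "0 \<le> \<bar>a\<bar> ^ 3" "0 \<le> B * \<bar>a\<bar>\<^sup>2" "0 \<le> B\<^sup>2 * \<bar>a\<bar>" "0 \<le> B * \<bar>a\<bar>" "0 \<le> \<bar>a\<bar>\<^sup>2"
      using B0 by auto
    from k show ?thesis
    proof
      assume [simp]: "k = 2"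
      have "(a + b) ^ k - b ^ k = a\<^sup>2 + 2 * (b * a)" by (simp add: power2_eq_square algebra_simps)
      then have "\<bar>(a + b) ^ k - b ^ k\<bar> \<le> \<bar>a\<^sup>2\<bar> + \<bar>2 * (b * a)\<bar>" by (simp only: abs_triangle_ineq)
      then have "\<bar>(a + b) ^ k - b ^ k\<bar> \<le> \<bar>a\<bar>\<^sup>2 + 2 * (\<bar>b\<bar> * \<bar>a\<bar>)" by (simp add: abs_mult)
      then show ?thesis using 1 nn unfolding distrib_right power_one_right mult_1 mult.assoc by linarith
    next
      assume [simp]: "k = 3"
      have "(a + b) ^ k - b ^ k = a ^ 3 + 3 * (b * a\<^sup>2) + 3 * (b\<^sup>2 * a)"
        by (simp add: power2_eq_square power3_eq_cube algebra_simps)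
      then have "\<bar>(a + b) ^ k - b ^ k\<bar> \<le> \<bar>a ^ 3\<bar> + \<bar>3 * (b * a\<^sup>2)\<bar> + \<bar>3 * (b\<^sup>2 * a)\<bar>" by linarith
      then have "\<bar>(a + b) ^ k - b ^ k\<bar> \<le> \<bar>a\<bar> ^ 3 + 3 * (\<bar>b\<bar> * \<bar>a\<bar>\<^sup>2) + 3 * (\<bar>b\<bar>\<^sup>2 * \<bar>a\<bar>)"
        by (simp add: abs_mult power_abs)
      then show ?thesis using 1 nn unfolding distrib_right power_one_right mult_1 mult.assoc by linarith
    qed
  qed
  have "(\<lambda>n. (\<integral>x. g n x ^ k \<partial>M) - (\<integral>x. f x ^ k \<partial>M)) \<longlonglongrightarrow> 0"
  proof (rule tendsto_0_le[where K = 1])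
    show "(\<lambda>n. (\<integral>x. \<bar>d n x\<bar> ^ 3 \<partial>M) + (1 + 3 * B) * (\<integral>x. \<bar>d n x\<bar>\<^sup>2 \<partial>M)
        + (2 * B + 3 * B\<^sup>2) * (\<integral>x. \<bar>d n x\<bar> ^ 1 \<partial>M)) \<longlonglongrightarrow> 0"
      using tendsto_add[OF tendsto_add[OF dj[of 3] tendsto_mult_left[OF dj[of 2], of "1 + 3 * B"]]
          tendsto_mult_left[OF dj[of 1], of "2 * B + 3 * B\<^sup>2"]] by simp
    show "\<forall>\<^sub>F n in sequentially. norm ((\<integral>x. g n x ^ k \<partial>M) - (\<integral>x. f x ^ k \<partial>M))
      \<le> norm ((\<integral>x. \<bar>d n x\<bar> ^ 3 \<partial>M) + (1 + 3 * B) * (\<integral>x. \<bar>d n x\<bar>\<^sup>2 \<partial>M)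
        + (2 * B + 3 * B\<^sup>2) * (\<integral>x. \<bar>d n x\<bar> ^ 1 \<partial>M)) * 1"
    proof (rule always_eventually, rule allI)
      fix n
      have gk: "integrable M (\<lambda>x. g n x ^ k)" "integrable M (\<lambda>x. f x ^ k)"
        using k integrable_power_of_abs_cube[OF _ int[of n], of k] integrable_power_of_abs_cube[OF _ intf, of k]
        by auto
      have "\<bar>(\<integral>x. g n x ^ k \<partial>M) - (\<integral>x. f x ^ k \<partial>M)\<bar> = \<bar>\<integral>x. (d n x + f x) ^ k - f x ^ k \<partial>M\<bar>"
        using gk by (simp add: d_def)
      also have "\<dots> \<le> (\<integral>x. \<bar>(d n x + f x) ^ k - f x ^ k\<bar> \<partial>M)"
        by (rule integral_abs_bound)
      also have "\<dots> \<le> (\<integral>x. \<bar>d n x\<bar> ^ 3 + (1 + 3 * B) * \<bar>d n x\<bar>\<^sup>2 + (2 * B + 3 * B\<^sup>2) * \<bar>d n x\<bar> ^ 1 \<partial>M)"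
        using gk by (intro integral_mono pw B integrable_abs Bochner_Integration.integrable_diff
            Bochner_Integration.integrable_add integrable_mult_right ik) (auto simp: d_def)
      also have "\<dots> = (\<integral>x. \<bar>d n x\<bar> ^ 3 \<partial>M) + (1 + 3 * B) * (\<integral>x. \<bar>d n x\<bar>\<^sup>2 \<partial>M)
        + (2 * B + 3 * B\<^sup>2) * (\<integral>x. \<bar>d n x\<bar> ^ 1 \<partial>M)"
        using ik[of 3 n] ik[of 2 n] ik[of 1 n] by (simp del: power2_abs)
      finally show "norm ((\<integral>x. g n x ^ k \<partial>M) - (\<integral>x. f x ^ k \<partial>M))
      \<le> norm ((\<integral>x. \<bar>d n x\<bar> ^ 3 \<partial>M) + (1 + 3 * B) * (\<integral>x. \<bar>d n x\<bar>\<^sup>2 \<partial>M)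
        + (2 * B + 3 * B\<^sup>2) * (\<integral>x. \<bar>d n x\<bar> ^ 1 \<partial>M)) * 1"
        by simp
    qed
  qed
  then show ?thesis by (simp add: LIM_zero_iff)
qed

text \<open>Up to the third power, every cross term in the expansion of \<open>Z i + S\<close>
  contains a first power of \<open>Z i\<close> or of \<open>S\<close>. Both are centred, so by
  independence the cross terms vanish.\<close>

lemma (in prob_space) indep_vars_sum_moments:
  fixes Z :: "'i \<Rightarrow> 'a \<Rightarrow> real"
  assumes "finite I" "indep_vars (\<lambda>_. borel) Z I"
    and "\<And>i. i \<in> I \<Longrightarrow> integrable M (\<lambda>\<omega>. \<bar>Z i \<omega>\<bar> ^ 3)"
    and "\<And>i. i \<in> I \<Longrightarrow> expectation (Z i) = 0"
  shows "expectation (\<lambda>\<omega>. \<Sum>i\<in>I. Z i \<omega>) = 0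
    \<and> expectation (\<lambda>\<omega>. (\<Sum>i\<in>I. Z i \<omega>)\<^sup>2) = (\<Sum>i\<in>I. expectation (\<lambda>\<omega>. (Z i \<omega>)\<^sup>2))
    \<and> expectation (\<lambda>\<omega>. (\<Sum>i\<in>I. Z i \<omega>) ^ 3) = (\<Sum>i\<in>I. expectation (\<lambda>\<omega>. Z i \<omega> ^ 3))"
  using assms
proof (induction I rule: finite_induct)
  case empty
  then show ?case by simp
next
  case (insert i I)
  define S where "S \<omega> = (\<Sum>i\<in>I. Z i \<omega>)" for \<omega>
  have rv: "random_variable borel (Z j)" if "j \<in> insert i I" for j
    using insert.prems(1) that by (auto simp: indep_vars_def)
  have [measurable]: "random_variable borel (Z i)" using rv by simp
  have [measurable]: "random_variable borel S"
    unfolding S_def using rv by (intro borel_measurable_sum) auto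
  have S3: "integrable M (\<lambda>\<omega>. \<bar>S \<omega>\<bar> ^ 3)"
    unfolding S_def using insert.hyps insert.prems rv by (intro integrable_abs_cube_sum) auto
  have S: "integrable M (\<lambda>\<omega>. S \<omega> ^ k)" and Z: "integrable M (\<lambda>\<omega>. Z i \<omega> ^ k)" if "k \<le> 3" for k
    using integrable_power_of_abs_cube[OF _ S3 that] integrable_power_of_abs_cube[OF _ insert.prems(2) that, of i]
    by auto
  have IH: "expectation S = 0" "expectation (\<lambda>\<omega>. (S \<omega>)\<^sup>2) = (\<Sum>i\<in>I. expectation (\<lambda>\<omega>. (Z i \<omega>)\<^sup>2))"
      "expectation (\<lambda>\<omega>. S \<omega> ^ 3) = (\<Sum>i\<in>I. expectation (\<lambda>\<omega>. Z i \<omega> ^ 3))"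
    using insert.IH indep_vars_subset[OF insert.prems(1)] insert.prems(2,3) unfolding S_def by auto
  have ind: "indep_var borel (Z i) borel S"
    unfolding S_def using insert.hyps insert.prems by (intro indep_vars_sum) auto
  \<comment> \<open>Independence alone makes the products integrable; third moments of the two
    factors are enough.\<close>
  have pair: "integrable M (\<lambda>\<omega>. Z i \<omega> ^ k * S \<omega> ^ j) \<and>
      expectation (\<lambda>\<omega>. Z i \<omega> ^ k * S \<omega> ^ j) = expectation (\<lambda>\<omega>. Z i \<omega> ^ k) * expectation (\<lambda>\<omega>. S \<omega> ^ j)"
    if "k \<le> 3" "j \<le> 3" for k j
  proof -
    have "indep_var borel ((\<lambda>x. x ^ k) \<circ> Z i) borel ((\<lambda>x. x ^ j) \<circ> S)"
      by (rule indep_var_compose[OF ind]) measurable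
    then have "indep_var borel (\<lambda>\<omega>. Z i \<omega> ^ k) borel (\<lambda>\<omega>. S \<omega> ^ j)"
      by (simp add: comp_def)
    then show ?thesis
      using indep_var_lebesgue_integral indep_var_integrable S[OF that(2)] Z[OF that(1)] by blast
  qed
  have Zi: "expectation (Z i) = 0" using insert.prems(3) by simp
  have sum: "(\<Sum>j\<in>insert i I. Z j \<omega>) = Z i \<omega> + S \<omega>" for \<omega>
    using insert.hyps by (simp add: S_def)
  have e1: "expectation (\<lambda>\<omega>. Z i \<omega> + S \<omega>) = 0"
    using S[of 1] Z[of 1] by (simp add: IH Zi)
  have "(\<lambda>\<omega>. (Z i \<omega> + S \<omega>)\<^sup>2) = (\<lambda>\<omega>. (Z i \<omega>)\<^sup>2 + 2 * (Z i \<omega> ^ 1 * S \<omega> ^ 1) + (S \<omega>)\<^sup>2)"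
    by (simp add: power2_eq_square algebra_simps)
  then have e2: "expectation (\<lambda>\<omega>. (Z i \<omega> + S \<omega>)\<^sup>2) = expectation (\<lambda>\<omega>. (Z i \<omega>)\<^sup>2) + expectation (\<lambda>\<omega>. (S \<omega>)\<^sup>2)"
    using S[of 2] Z[of 2] pair[of 1 1] by (simp add: IH Zi)
  have "(\<lambda>\<omega>. (Z i \<omega> + S \<omega>) ^ 3)
      = (\<lambda>\<omega>. Z i \<omega> ^ 3 + 3 * (Z i \<omega> ^ 2 * S \<omega> ^ 1) + 3 * (Z i \<omega> ^ 1 * S \<omega> ^ 2) + S \<omega> ^ 3)"
    by (simp add: power2_eq_square power3_eq_cube algebra_simps)
  then have e3: "expectation (\<lambda>\<omega>. (Z i \<omega> + S \<omega>) ^ 3) = expectation (\<lambda>\<omega>. Z i \<omega> ^ 3) + expectation (\<lambda>\<omega>. S \<omega> ^ 3)"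
    using S[of 3] Z[of 3] pair[of 1 2] pair[of 2 1] by (simp add: IH Zi)
  show ?case
    unfolding sum e1 e2 e3 IH using insert.hyps by simp
qed

text \<open>A moment inequality of Rosenthal type, obtained for nonnegative summands from the
  additivity of central moments and the resulting lower bound on the centred sum.\<close>

lemma (in prob_space) expectation_abs_cube_centered_sum:
  fixes Y :: "'i \<Rightarrow> 'a \<Rightarrow> real"
  assumes I: "finite I" and ind: "indep_vars (\<lambda>_. borel) Y I"
    and nn: "\<And>i \<omega>. i \<in> I \<Longrightarrow> 0 \<le> Y i \<omega>"
    and int: "\<And>i. i \<in> I \<Longrightarrow> integrable M (\<lambda>\<omega>. Y i \<omega> ^ 3)"
  defines "m \<equiv> \<Sum>i\<in>I. expectation (Y i)"
  shows "integrable M (\<lambda>\<omega>. \<bar>(\<Sum>i\<in>I. Y i \<omega>) - m\<bar> ^ 3)"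
    and "expectation (\<lambda>\<omega>. \<bar>(\<Sum>i\<in>I. Y i \<omega>) - m\<bar> ^ 3)
      \<le> (\<Sum>i\<in>I. expectation (\<lambda>\<omega>. Y i \<omega> ^ 3)) + 2 * m * (\<Sum>i\<in>I. expectation (\<lambda>\<omega>. (Y i \<omega>)\<^sup>2))"
proof -
  define Z where "Z i \<omega> = Y i \<omega> - expectation (Y i)" for i \<omega>
  have rv[measurable]: "random_variable borel (Y i)" if "i \<in> I" for i
    using ind that by (auto simp: indep_vars_def)
  have intY: "integrable M (\<lambda>\<omega>. Y i \<omega> ^ k)" if "k \<le> 3" "i \<in> I" for i k
    using integrable_power_of_abs_cube[of "Y i" k] int[of i] nn[of i] that rv by simp
  have E0: "0 \<le> expectation (Y i)" if "i \<in> I" for i using nn[OF that] by simp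
  have m0: "0 \<le> m" unfolding m_def by (intro sum_nonneg E0)
  have rvZ: "random_variable borel (Z i)" if "i \<in> I" for i unfolding Z_def using that by measurable
  have Z3: "integrable M (\<lambda>\<omega>. \<bar>Z i \<omega>\<bar> ^ 3)" if "i \<in> I" for i
    unfolding Z_def using that int[OF that] nn[OF that] by (intro integrable_abs_cube_diff) auto
  have intZ: "integrable M (\<lambda>\<omega>. Z i \<omega> ^ k)" if "k \<le> 3" "i \<in> I" for i k
    using integrable_power_of_abs_cube[OF rvZ Z3] that by simp
  have indZ: "indep_vars (\<lambda>_. borel) Z I"
    unfolding Z_def using indep_vars_compose2[OF ind, where Y = "\<lambda>i y. y - expectation (Y i)" and N = "\<lambda>_. borel"]
    by simp
  have Z0: "expectation (Z i) = 0" if "i \<in> I" for i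
    unfolding Z_def using intY[of 1 i] that by (simp add: prob_space)
  define S where "S \<omega> = (\<Sum>i\<in>I. Z i \<omega>)" for \<omega>
  have S_eq: "S \<omega> = (\<Sum>i\<in>I. Y i \<omega>) - m" for \<omega>
    by (simp add: S_def Z_def m_def sum_subtractf)
  have [measurable]: "random_variable borel S" unfolding S_def using rvZ by measurable
  have S3: "integrable M (\<lambda>\<omega>. \<bar>S \<omega>\<bar> ^ 3)"
    unfolding S_def by (intro integrable_abs_cube_sum I rvZ Z3)
  then show "integrable M (\<lambda>\<omega>. \<bar>(\<Sum>i\<in>I. Y i \<omega>) - m\<bar> ^ 3)" by (simp add: S_eq)
  have intS: "integrable M (\<lambda>\<omega>. S \<omega> ^ k)" if "k \<le> 3" for k
    using that by (rule integrable_power_of_abs_cube[OF _ S3, rotated]) measurable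
  have mom: "expectation (\<lambda>\<omega>. (S \<omega>)\<^sup>2) = (\<Sum>i\<in>I. expectation (\<lambda>\<omega>. (Z i \<omega>)\<^sup>2))"
      "expectation (\<lambda>\<omega>. S \<omega> ^ 3) = (\<Sum>i\<in>I. expectation (\<lambda>\<omega>. Z i \<omega> ^ 3))"
    using indep_vars_sum_moments[OF I indZ Z3 Z0] unfolding S_def by auto
  text \<open>Since \<open>S \<ge> - m\<close>, the third absolute moment is controlled by moments without absolute values.\<close>
  have pw: "\<bar>s\<bar> ^ 3 \<le> s ^ 3 + 2 * m * s\<^sup>2" if "- m \<le> s" for s
  proof (cases "s \<ge> 0")
    case False
    then have "- 2 * s * s\<^sup>2 \<le> 2 * m * s\<^sup>2" using that by (intro mult_right_mono) auto
    with False show ?thesis by (simp add: power3_eq_cube power2_eq_square)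
  qed (use m0 in auto)
  have "expectation (\<lambda>\<omega>. \<bar>S \<omega>\<bar> ^ 3) \<le> expectation (\<lambda>\<omega>. S \<omega> ^ 3 + 2 * m * (S \<omega>)\<^sup>2)"
    using S3 intS by (intro integral_mono pw) (auto simp: S_eq intro!: sum_nonneg nn)
  also have "\<dots> = (\<Sum>i\<in>I. expectation (\<lambda>\<omega>. Z i \<omega> ^ 3)) + 2 * m * (\<Sum>i\<in>I. expectation (\<lambda>\<omega>. (Z i \<omega>)\<^sup>2))"
    using intS[of 3] intS[of 2] by (simp add: mom)
  also have "\<dots> \<le> (\<Sum>i\<in>I. expectation (\<lambda>\<omega>. Y i \<omega> ^ 3)) + 2 * m * (\<Sum>i\<in>I. expectation (\<lambda>\<omega>. (Y i \<omega>)\<^sup>2))"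
  proof (intro add_mono mult_left_mono sum_mono)
    fix i assume i: "i \<in> I"
    \<comment> \<open>The mean of \<open>Y i\<close> is nonnegative, so \<open>Z i\<close> lies
      below \<open>Y i\<close>, and the cube is monotone on the whole line.\<close>
    show "expectation (\<lambda>\<omega>. Z i \<omega> ^ 3) \<le> expectation (\<lambda>\<omega>. Y i \<omega> ^ 3)"
      using i intY intZ E0 by (intro integral_mono power_mono_odd) (auto simp: Z_def)
    have "expectation (\<lambda>\<omega>. (Z i \<omega>)\<^sup>2) = expectation (\<lambda>\<omega>. (Y i \<omega>)\<^sup>2) - (expectation (Y i))\<^sup>2"
      unfolding Z_def using i intY[of 2 i] intY[of 1 i] by (intro variance_eq) auto
    then show "expectation (\<lambda>\<omega>. (Z i \<omega>)\<^sup>2) \<le> expectation (\<lambda>\<omega>. (Y i \<omega>)\<^sup>2)" by simp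
  qed (use m0 in auto)
  finally show "expectation (\<lambda>\<omega>. \<bar>(\<Sum>i\<in>I. Y i \<omega>) - m\<bar> ^ 3)
      \<le> (\<Sum>i\<in>I. expectation (\<lambda>\<omega>. Y i \<omega> ^ 3)) + 2 * m * (\<Sum>i\<in>I. expectation (\<lambda>\<omega>. (Y i \<omega>)\<^sup>2))"
    by (simp add: S_eq)
qed

section \<open>Kernel density estimation\<close>

text \<open>The density enters only through an upper bound \<open>B\<close> and a Lipschitz constant
  \<open>L\<close> on the positive half-line. A jump of \<open>f\<close> at the origin is
  allowed.\<close>

locale kernel_density_sample = prob_space M for M :: "'a measure" +
  fixes X :: "nat \<Rightarrow> 'a \<Rightarrow> real" and f K :: "real \<Rightarrow> real" and B L :: real
  assumes indep: "indep_vars (\<lambda>_. borel) X {1..}"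
    and density: "\<And>i. i \<ge> 1 \<Longrightarrow> distributed M lborel (X i) (\<lambda>x. ennreal (f x))"
    and f_nonneg: "\<And>x. f x \<ge> 0"
    and f_support: "\<And>x. x \<le> 0 \<Longrightarrow> f x = 0"
    and f_le: "\<And>x. f x \<le> B"
    and f_lipschitz: "\<And>x y. 0 < x \<Longrightarrow> 0 < y \<Longrightarrow> \<bar>f x - f y\<bar> \<le> L * \<bar>x - y\<bar>"
    and K_meas[measurable]: "K \<in> borel_measurable borel"
    and K_nonneg: "\<And>t. K t \<ge> 0"
    and K_density: "has_bochner_integral lborel K 1"
    and K_moment: "integrable lborel (\<lambda>t. \<bar>t\<bar> * K t)"
    and K_cube: "integrable lborel (\<lambda>t. K t ^ 3)"
begin

lemma f_meas[measurable]: "f \<in> borel_measurable borel"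
  using distributed_real_measurable[OF _ density[of 1]] f_nonneg by simp

lemma B_nonneg: "0 \<le> B"
  using f_nonneg[of 0] f_le[of 0] by simp

lemma L_nonneg: "0 \<le> L"
  using f_lipschitz[of 1 2] by simp

lemma X_meas[measurable]: "i \<ge> 1 \<Longrightarrow> random_variable borel (X i)"
  using indep by (auto simp: indep_vars_def)

text \<open>The mean of the kernel estimator with bandwidth \<open>b\<close>: the convolution of
  \<open>f\<close> with the rescaled kernel.\<close>

definition smoothed :: "real \<Rightarrow> real \<Rightarrow> real" where
  "smoothed b t = (\<integral>y. f y * (K ((t - y) / b) / b) \<partial>lborel)"

lemma K_power_integrable:
  assumes "1 \<le> k" "k \<le> 3"
  shows "integrable lborel (\<lambda>t. K t ^ k)"
proof (rule Bochner_Integration.integrable_bound)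
  show "integrable lborel (\<lambda>t. K t + K t ^ 3)"
    using K_density K_cube by (auto simp: has_bochner_integral_iff)
  have "x ^ k \<le> x + x ^ 3" if "x \<ge> 0" for x :: real
  proof (cases "x \<le> 1")
    case True
    then have "x ^ k \<le> x ^ 1" using assms that by (intro power_decreasing) auto
    with that show ?thesis by (simp add: add_increasing2)
  next
    case False
    then have "x ^ k \<le> x ^ 3" using assms by (intro power_increasing) auto
    with that show ?thesis by simp
  qed
  then show "AE t in lborel. norm (K t ^ k) \<le> norm (K t + K t ^ 3)"
    using K_nonneg by (intro AE_I2) simp
qed measurable

text \<open>Both orientations occur: the data point is the variable in expectations, the evaluation
  point in integrals over the interval.\<close>

lemma K_scaled_integrable:
  assumes "1 \<le> k" "k \<le> 3" "b > 0"
  shows "integrable lborel (\<lambda>y. K ((t - y) / b) ^ k)" "integrable lborel (\<lambda>y. K ((y - t) / b) ^ k)"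
  using lborel_integrable_real_affine[OF K_power_integrable[OF assms(1,2)], of "- 1 / b" "t / b"]
    lborel_integrable_real_affine[OF K_power_integrable[OF assms(1,2)], of "1 / b" "- t / b"] assms
  by (simp_all add: diff_divide_distrib)

lemma K_scaled_integral:
  assumes "b > 0"
  shows "(\<integral>y. K ((t - y) / b) ^ k \<partial>lborel) = b * (\<integral>u. K u ^ k \<partial>lborel)"
    "(\<integral>y. K ((y - t) / b) ^ k \<partial>lborel) = b * (\<integral>u. K u ^ k \<partial>lborel)"
  using lborel_integral_real_affine[of "- 1 / b" "\<lambda>u. K u ^ k" "t / b"]
    lborel_integral_real_affine[of "1 / b" "\<lambda>u. K u ^ k" "- t / b"] assms
  by (simp_all add: diff_divide_distrib)

text \<open>Bounding the density by \<open>B\<close> leaves an integral of the kernel alone, and the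
  change of variables contributes the factor \<open>b\<close>.\<close>

lemma kernel_moment:
  assumes "1 \<le> k" "k \<le> 3" "b > 0" "i \<ge> 1"
  shows "integrable M (\<lambda>\<omega>. K ((t - X i \<omega>) / b) ^ k)"
    and "expectation (\<lambda>\<omega>. K ((t - X i \<omega>) / b) ^ k) \<le> B * (b * (\<integral>u. K u ^ k \<partial>lborel))"
proof -
  have int: "integrable lborel (\<lambda>y. f y * K ((t - y) / b) ^ k)"
  proof (rule Bochner_Integration.integrable_bound)
    show "integrable lborel (\<lambda>y. B * K ((t - y) / b) ^ k)"
      using K_scaled_integrable[OF assms(1-3)] by simp
    show "AE y in lborel. norm (f y * K ((t - y) / b) ^ k) \<le> norm (B * K ((t - y) / b) ^ k)"
      using f_nonneg f_le B_nonneg by (intro AE_I2) (auto simp: abs_mult intro!: mult_right_mono)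
  qed measurable
  then show "integrable M (\<lambda>\<omega>. K ((t - X i \<omega>) / b) ^ k)"
    using distributed_integrable[OF density[OF assms(4)], of "\<lambda>y. K ((t - y) / b) ^ k"] f_nonneg by simp
  have "expectation (\<lambda>\<omega>. K ((t - X i \<omega>) / b) ^ k) = (\<integral>y. f y * K ((t - y) / b) ^ k \<partial>lborel)"
    using distributed_integral[OF density[OF assms(4)], of "\<lambda>y. K ((t - y) / b) ^ k"] f_nonneg by simp
  also have "\<dots> \<le> (\<integral>y. B * K ((t - y) / b) ^ k \<partial>lborel)"
    using int K_scaled_integrable[OF assms(1-3)] f_le K_nonneg
    by (intro integral_mono) (auto intro!: mult_right_mono)
  also have "\<dots> = B * (b * (\<integral>u. K u ^ k \<partial>lborel))"
    using assms by (simp add: K_scaled_integral)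
  finally show "expectation (\<lambda>\<omega>. K ((t - X i \<omega>) / b) ^ k) \<le> B * (b * (\<integral>u. K u ^ k \<partial>lborel))" .
qed

lemma expectation_kernel:
  assumes "i \<ge> 1"
  shows "expectation (\<lambda>\<omega>. K ((t - X i \<omega>) / b) / b) = smoothed b t"
  unfolding smoothed_def using distributed_integral[OF density[OF assms], of "\<lambda>y. K ((t - y) / b) / b"] f_nonneg
  by (auto dest: sym)

lemma smoothed_bounds:
  assumes "b > 0"
  shows "0 \<le> smoothed b t" "smoothed b t \<le> B"
proof -
  show "0 \<le> smoothed b t"
    unfolding smoothed_def using f_nonneg K_nonneg assms by (intro Bochner_Integration.integral_nonneg) auto
  have "smoothed b t = expectation (\<lambda>\<omega>. K ((t - X 1 \<omega>) / b) ^ 1) / b"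
    using expectation_kernel[of 1 t b] by simp
  also have "\<dots> \<le> B * (b * (\<integral>u. K u ^ 1 \<partial>lborel)) / b"
    using assms kernel_moment(2)[of 1 b 1 t] by (intro divide_right_mono) auto
  also have "\<dots> = B"
    using assms K_density by (simp add: has_bochner_integral_iff)
  finally show "smoothed b t \<le> B" .
qed

text \<open>The bias is an average of \<open>f (t - b * u) - f t\<close> under \<open>K\<close>. For
  \<open>t - b * u\<close> positive the Lipschitz bound applies. Otherwise
  \<open>b * \<bar>u\<bar>\<close> is at least \<open>t1\<close>, so the trivial bound
  \<open>B\<close> is at most \<open>B / t1 * (b * \<bar>u\<bar>)\<close>.\<close>

lemma smoothed_bias:
  assumes b: "b > 0" and t: "0 < t1" "t1 \<le> t"
  shows "\<bar>smoothed b t - f t\<bar> \<le> (L + B / t1) * b * (\<integral>u. \<bar>u\<bar> * K u \<partial>lborel)"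
proof -
  have K1: "integrable lborel K" "(\<integral>u. K u \<partial>lborel) = 1"
    using K_density by (auto simp: has_bochner_integral_iff)
  have int: "integrable lborel (\<lambda>u. f (t - b * u) * K u)"
  proof (rule Bochner_Integration.integrable_bound)
    show "integrable lborel (\<lambda>u. B * K u)" using K1 by simp
    show "AE u in lborel. norm (f (t - b * u) * K u) \<le> norm (B * K u)"
      using f_nonneg f_le B_nonneg K_nonneg by (intro AE_I2) (auto simp: abs_mult intro!: mult_right_mono)
  qed measurable
  \<comment> \<open>Substitution \<open>y = t - b * u\<close>.\<close>
  have "smoothed b t = \<bar>- b\<bar> *\<^sub>R (\<integral>u. f (t + - b * u) * (K ((t - (t + - b * u)) / b) / b) \<partial>lborel)"
    unfolding smoothed_def by (rule lborel_integral_real_affine) (use b in simp)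
  also have "\<dots> = (\<integral>u. f (t - b * u) * K u \<partial>lborel)"
    using b by simp
  finally have "smoothed b t - f t = (\<integral>u. f (t - b * u) * K u - f t * K u \<partial>lborel)"
    using int K1 by simp
  also have "\<bar>\<dots>\<bar> \<le> (\<integral>u. \<bar>f (t - b * u) * K u - f t * K u\<bar> \<partial>lborel)"
    by (rule integral_abs_bound)
  also have "\<dots> \<le> (\<integral>u. (L + B / t1) * b * (\<bar>u\<bar> * K u) \<partial>lborel)"
  proof (rule integral_mono)
    fix u
    have "\<bar>f (t - b * u) - f t\<bar> \<le> (L + B / t1) * (b * \<bar>u\<bar>)"
    proof (cases "0 < t - b * u")
      case True
      have "\<bar>f (t - b * u) - f t\<bar> \<le> L * (b * \<bar>u\<bar>)"
        using f_lipschitz[OF True, of t] t b by (simp add: abs_mult)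
      also have "\<dots> \<le> (L + B / t1) * (b * \<bar>u\<bar>)"
        using b t B_nonneg by (intro mult_right_mono) auto
      finally show ?thesis .
    next
      case False
      then have "t1 \<le> b * u" using t by simp
      also have "b * u \<le> b * \<bar>u\<bar>" using b by (intro mult_left_mono) auto
      finally have "t1 \<le> b * \<bar>u\<bar>" .
      then have "1 \<le> b * \<bar>u\<bar> / t1" using t by simp
      have "\<bar>f (t - b * u) - f t\<bar> \<le> B * 1"
        using False f_support[of "t - b * u"] f_nonneg[of t] f_le[of t] by simp
      also have "\<dots> \<le> B * (b * \<bar>u\<bar> / t1)"
        by (intro mult_left_mono B_nonneg) fact
      also have "\<dots> \<le> (L + B / t1) * (b * \<bar>u\<bar>)"
        using L_nonneg b by (simp add: distrib_right)
      finally show ?thesis .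
    qed
    then have "\<bar>f (t - b * u) - f t\<bar> * K u \<le> (L + B / t1) * (b * \<bar>u\<bar>) * K u"
      using K_nonneg by (rule mult_right_mono)
    moreover have "\<bar>f (t - b * u) * K u - f t * K u\<bar> = \<bar>f (t - b * u) - f t\<bar> * K u"
      using K_nonneg[of u] by (simp add: abs_mult flip: left_diff_distrib)
    ultimately show "\<bar>f (t - b * u) * K u - f t * K u\<bar> \<le> (L + B / t1) * b * (\<bar>u\<bar> * K u)"
      by (simp only: mult_ac)
  qed (use int K1 K_moment in auto)
  also have "\<dots> = (L + B / t1) * b * (\<integral>u. \<bar>u\<bar> * K u \<partial>lborel)"
    by simp
  finally show ?thesis .
qed

text \<open>At a fixed point the estimator is a sum of independent nonnegative terms with total mean
  \<open>smoothed (h n) t\<close>, which is at most \<open>B\<close>;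
  \<open>expectation_abs_cube_centered_sum\<close> applies.\<close>

lemma kde_abs_cube_deviation:
  fixes h :: "nat \<Rightarrow> real"
  assumes n: "n \<ge> 1" and h: "h n > 0"
  shows "integrable M (\<lambda>\<omega>. \<bar>kernel_density_estimator K h (\<lambda>i. X i \<omega>) n t - smoothed (h n) t\<bar> ^ 3)"
    and "expectation (\<lambda>\<omega>. \<bar>kernel_density_estimator K h (\<lambda>i. X i \<omega>) n t - smoothed (h n) t\<bar> ^ 3)
      \<le> B * (\<integral>u. K u ^ 3 \<partial>lborel) / (real n * h n)\<^sup>2 + 2 * B\<^sup>2 * (\<integral>u. (K u)\<^sup>2 \<partial>lborel) / (real n * h n)"
proof -
  let ?N = "real n * h n"
  have N: "?N > 0" using n h by simp
  define Y where "Y i \<omega> = K ((t - X i \<omega>) / h n) / ?N" for i \<omega>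
  have kde: "kernel_density_estimator K h (\<lambda>i. X i \<omega>) n t = (\<Sum>i\<in>{1..n}. Y i \<omega>)" for \<omega>
    by (simp add: kernel_density_estimator_def Y_def sum_divide_distrib)
  have ind: "indep_vars (\<lambda>_. borel) Y {1..n}"
    unfolding Y_def
    by (rule indep_vars_compose2[OF indep_vars_subset[OF indep], where Y = "\<lambda>_ x. K ((t - x) / h n) / ?N"]) auto
  have nn: "0 \<le> Y i \<omega>" for i \<omega> using N K_nonneg by (simp add: Y_def)
  have int: "integrable M (\<lambda>\<omega>. Y i \<omega> ^ 3)" if "i \<in> {1..n}" for i
    using kernel_moment(1)[of 3 "h n" i t] that h by (simp add: Y_def power_divide)
  \<comment> \<open>The \<open>n\<close> summands and the factor \<open>h n\<close> from
    \<open>kernel_moment\<close> together cancel one of the \<open>k\<close> factors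
    \<open>real n * h n\<close> in the denominator.\<close>
  have mom: "(\<Sum>i\<in>{1..n}. expectation (\<lambda>\<omega>. Y i \<omega> ^ k)) \<le> B * (\<integral>u. K u ^ k \<partial>lborel) / ?N ^ (k - 1)"
    if k: "1 \<le> k" "k \<le> 3" for k
  proof -
    have "expectation (\<lambda>\<omega>. Y i \<omega> ^ k) \<le> B * (h n * (\<integral>u. K u ^ k \<partial>lborel)) / ?N ^ k" if "i \<in> {1..n}" for i
      using kernel_moment(2)[OF k h, of i t] that N by (simp add: Y_def power_divide divide_right_mono)
    then have "(\<Sum>i\<in>{1..n}. expectation (\<lambda>\<omega>. Y i \<omega> ^ k))
        \<le> (\<Sum>i\<in>{1..n}. B * (h n * (\<integral>u. K u ^ k \<partial>lborel)) / ?N ^ k)"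
      by (intro sum_mono)
    also have "\<dots> = B * (\<integral>u. K u ^ k \<partial>lborel) * ?N / (?N * ?N ^ (k - 1))"
      using k by (cases k) auto
    also have "\<dots> = B * (\<integral>u. K u ^ k \<partial>lborel) / ?N ^ (k - 1)"
      by (rule nonzero_mult_divide_mult_cancel_right2) (use n h in simp)
    finally show ?thesis .
  qed
  have Y_eq: "Y i = (\<lambda>\<omega>. K ((t - X i \<omega>) / h n) / h n / n)" for i
    by (simp add: Y_def fun_eq_iff mult.commute)
  have "expectation (Y i) = smoothed (h n) t / n" if "i \<in> {1..n}" for i
    using expectation_kernel[of i t "h n"] that unfolding Y_eq by (subst integral_divide_zero) simp
  then have m: "(\<Sum>i\<in>{1..n}. expectation (Y i)) = smoothed (h n) t"
    using n by simp
  note dev = expectation_abs_cube_centered_sum[OF _ ind nn int, unfolded m]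
  show "integrable M (\<lambda>\<omega>. \<bar>kernel_density_estimator K h (\<lambda>i. X i \<omega>) n t - smoothed (h n) t\<bar> ^ 3)"
    unfolding kde by (rule dev(1)) auto
  have "expectation (\<lambda>\<omega>. \<bar>kernel_density_estimator K h (\<lambda>i. X i \<omega>) n t - smoothed (h n) t\<bar> ^ 3)
    \<le> (\<Sum>i\<in>{1..n}. expectation (\<lambda>\<omega>. Y i \<omega> ^ 3)) + 2 * smoothed (h n) t * (\<Sum>i\<in>{1..n}. expectation (\<lambda>\<omega>. (Y i \<omega>)\<^sup>2))"
    unfolding kde by (rule dev(2)) auto
  also have "\<dots> \<le> B * (\<integral>u. K u ^ 3 \<partial>lborel) / ?N ^ (3 - 1)
      + 2 * B * (B * (\<integral>u. (K u)\<^sup>2 \<partial>lborel) / ?N ^ (2 - 1))"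
    using smoothed_bounds[OF h, of t] B_nonneg
    by (intro add_mono mult_mono mom) (auto intro!: sum_nonneg)
  also have "\<dots> = B * (\<integral>u. K u ^ 3 \<partial>lborel) / ?N\<^sup>2 + 2 * B\<^sup>2 * (\<integral>u. (K u)\<^sup>2 \<partial>lborel) / ?N"
    by (simp add: power2_eq_square)
  finally show "expectation (\<lambda>\<omega>. \<bar>kernel_density_estimator K h (\<lambda>i. X i \<omega>) n t - smoothed (h n) t\<bar> ^ 3)
      \<le> B * (\<integral>u. K u ^ 3 \<partial>lborel) / ?N\<^sup>2 + 2 * B\<^sup>2 * (\<integral>u. (K u)\<^sup>2 \<partial>lborel) / ?N" .
qed

end

section \<open>Lebesgue measure on the interval and one-point updates\<close>

lemma interval_finite_measure: "finite_measure (restrict_space lborel {t1..t2 :: real})"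
  by (rule finite_measureI) (simp add: space_restrict_space emeasure_restrict_space emeasure_lborel_Icc_eq)

text \<open>Lets projections onto the interval be composed with Borel functions on the real
  line.\<close>

lemma interval_measurable:
  "g \<in> measurable N (restrict_space lborel {t1..t2 :: real}) \<Longrightarrow> g \<in> borel_measurable N"
  by (auto simp: measurable_restrict_space2_iff)

lemma integrable_interval:
  fixes g :: "real \<Rightarrow> real"
  assumes "integrable lborel g"
  shows "integrable (restrict_space lborel {t1..t2}) g"
  using integrable_mult_indicator[OF _ assms, of "{t1..t2}"] by (simp add: integrable_restrict_space)

lemma integral_interval_le:
  fixes g :: "real \<Rightarrow> real"
  assumes "integrable lborel g" "\<And>x. 0 \<le> g x"
  shows "(\<integral>x. g x \<partial>restrict_space lborel {t1..t2}) \<le> (\<integral>x. g x \<partial>lborel)"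
proof -
  have "(\<integral>x. g x \<partial>restrict_space lborel {t1..t2}) = (\<integral>x. indicator {t1..t2} x *\<^sub>R g x \<partial>lborel)"
    by (simp add: integral_restrict_space)
  also have "\<dots> \<le> (\<integral>x. g x \<partial>lborel)"
    using assms by (intro integral_mono integrable_mult_indicator) (auto simp: indicator_def)
  finally show ?thesis .
qed

lemma sum_fun_upd:
  fixes g :: "'b \<Rightarrow> real"
  assumes "finite A" "i \<in> A"
  shows "(\<Sum>j\<in>A. g ((x(i := y)) j)) = (\<Sum>j\<in>A. g (x j)) + (g y - g (x i))"
proof -
  have "(\<Sum>j\<in>A - {i}. g ((x(i := y)) j)) = (\<Sum>j\<in>A - {i}. g (x j))"
    by (rule sum.cong) auto
  then show ?thesis
    using sum.remove[OF assms, of "\<lambda>j. g ((x(i := y)) j)"] sum.remove[OF assms, of "\<lambda>j. g (x j)"] by simp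
qed

text \<open>Passes between the finite tuples of the concentration inequality and the full sample
  sequence.\<close>

lemma kernel_density_estimator_restrict:
  "kernel_density_estimator K h (restrict x {1..n}) n = kernel_density_estimator K h x n"
  by (simp add: kernel_density_estimator_def fun_eq_iff)

section \<open>The integrated error of the kernel estimator\<close>

context kernel_density_sample
begin

context
  fixes h :: "nat \<Rightarrow> real" and t1 t2 :: real
  assumes h_pos: "\<And>n. n \<ge> 1 \<Longrightarrow> h n > 0" and t1_pos: "0 < t1"
begin

abbreviation "\<mu> \<equiv> restrict_space lborel {t1..t2}"

text \<open>A function of the sample rather than of the outcome, so that one sample point can be
  replaced.\<close>

definition kde_error :: "nat \<Rightarrow> (nat \<Rightarrow> real) \<Rightarrow> real" where
  "kde_error n x = cube_norm \<mu> (\<lambda>t. kernel_density_estimator K h x n t - f t)"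

lemma kde_measurable: "kernel_density_estimator K h x n \<in> borel_measurable borel"
  unfolding kernel_density_estimator_def by measurable

lemma kde_measurable_interval: "kernel_density_estimator K h x n \<in> borel_measurable \<mu>"
  by (rule measurable_restrict_space1) (simp add: kde_measurable)

lemma f_measurable_interval: "f \<in> borel_measurable \<mu>"
  by (rule measurable_restrict_space1) simp

lemma scaled_kernel_cube_integrable:
  assumes "n \<ge> 1"
  shows "integrable \<mu> (\<lambda>t. \<bar>c * K ((t - a) / h n)\<bar> ^ 3)"
  using integrable_interval[OF K_scaled_integrable(2)[of 3 "h n" a], of t1 t2] h_pos[OF assms] K_nonneg
  by (simp add: abs_mult power_mult_distrib)

lemma scaled_kernel_measurable: "(\<lambda>t. c * K ((t - a) / b)) \<in> borel_measurable \<mu>"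
  by (rule measurable_restrict_space1) simp

lemma kde_cube_integrable:
  assumes "n \<ge> 1"
  shows "integrable \<mu> (\<lambda>t. \<bar>kernel_density_estimator K h x n t\<bar> ^ 3)"
  unfolding kernel_density_estimator_def sum_distrib_left
  by (intro integrable_abs_cube_sum scaled_kernel_cube_integrable scaled_kernel_measurable assms) simp

lemma f_cube_integrable: "integrable \<mu> (\<lambda>t. \<bar>f t\<bar> ^ 3)"
proof -
  interpret finite_measure \<mu> by (rule interval_finite_measure)
  show ?thesis
    using f_nonneg f_le f_measurable_interval
    by (intro integrable_const_bound[where B = "B ^ 3"]) (auto intro!: power_mono)
qed

lemma kde_diff_cube_integrable:
  assumes "n \<ge> 1"
  shows "integrable \<mu> (\<lambda>t. \<bar>kernel_density_estimator K h x n t - f t\<bar> ^ 3)"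
  by (intro integrable_abs_cube_diff kde_measurable_interval f_measurable_interval
      kde_cube_integrable f_cube_integrable assms)

lemma kde_error_nonneg: "0 \<le> kde_error n x"
  by (simp add: kde_error_def cube_norm_nonneg)

text \<open>Enlarging the interval to the real line permits the change of variables, which brings
  out \<open>h n\<close> under the root.\<close>

lemma scaled_kernel_cube_norm_le:
  assumes "n \<ge> 1" "c \<ge> 0"
  shows "cube_norm \<mu> (\<lambda>t. c * K ((t - a) / h n)) \<le> c * root 3 (h n * (\<integral>u. K u ^ 3 \<partial>lborel))"
proof -
  have "(\<integral>t. K ((t - a) / h n) ^ 3 \<partial>\<mu>) \<le> (\<integral>t. K ((t - a) / h n) ^ 3 \<partial>lborel)"
    using K_nonneg h_pos[OF assms(1)] by (intro integral_interval_le K_scaled_integrable) auto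
  then have "cube_norm \<mu> (\<lambda>t. K ((t - a) / h n)) \<le> root 3 (h n * (\<integral>u. K u ^ 3 \<partial>lborel))"
    using K_nonneg h_pos[OF assms(1)] by (simp add: cube_norm_def K_scaled_integral)
  then show ?thesis
    using assms by (simp add: cube_norm_cmult mult_left_mono)
qed

text \<open>An update adds one scaled kernel to the estimator and removes another; Minkowski's
  inequality bounds their effect by the two norms. The increment is of order
  \<open>1 / (n * h n powr (2/3))\<close>.\<close>

lemma kde_error_update_le:
  assumes i: "i \<in> {1..n}"
  shows "kde_error n (x(i := y)) \<le> kde_error n x + 2 / (real n * h n) * root 3 (h n * (\<integral>u. K u ^ 3 \<partial>lborel))"
proof -
  have n: "n \<ge> 1" using i by simp
  let ?c = "1 / (real n * h n)"
  have c: "?c \<ge> 0" using h_pos[OF n] by simp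
  let ?p = "\<lambda>t. ?c * K ((t - y) / h n)"
  let ?q = "\<lambda>t. - ?c * K ((t - x i) / h n)"
  let ?d = "\<lambda>t. kernel_density_estimator K h x n t - f t"
  have eq: "kernel_density_estimator K h (x(i := y)) n t - f t = ?d t + (?p t + ?q t)" for t
    unfolding kernel_density_estimator_def sum_fun_upd[OF finite_atLeastAtMost i, of "\<lambda>z. K ((t - z) / h n)" x y]
    by (simp add: algebra_simps)
  have d: "?d \<in> borel_measurable \<mu>"
    using kde_measurable_interval f_measurable_interval by measurable
  have pq: "(\<lambda>t. ?p t + ?q t) \<in> borel_measurable \<mu>"
    by (intro borel_measurable_add scaled_kernel_measurable)
  have "kde_error n (x(i := y)) \<le> cube_norm \<mu> ?d + cube_norm \<mu> (\<lambda>t. ?p t + ?q t)"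
    unfolding kde_error_def eq
    by (intro cube_norm_add d pq kde_diff_cube_integrable integrable_abs_cube_add
        scaled_kernel_cube_integrable scaled_kernel_measurable n)
  also have "cube_norm \<mu> (\<lambda>t. ?p t + ?q t) \<le> cube_norm \<mu> ?p + cube_norm \<mu> ?q"
    by (intro cube_norm_add scaled_kernel_cube_integrable scaled_kernel_measurable n)
  also have "cube_norm \<mu> ?q = cube_norm \<mu> (\<lambda>t. ?c * K ((t - x i) / h n))"
    unfolding cube_norm_cmult by simp
  also have "cube_norm \<mu> ?p + \<dots> \<le> ?c * root 3 (h n * (\<integral>u. K u ^ 3 \<partial>lborel)) + ?c * root 3 (h n * (\<integral>u. K u ^ 3 \<partial>lborel))"
    by (intro add_mono scaled_kernel_cube_norm_le n c)
  finally show ?thesis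
    by (simp add: kde_error_def del: fun_upd_apply)
qed

text \<open>Restoring the old value is itself an update, so the one-sided estimate holds in both
  directions.\<close>

lemma kde_error_bounded_differences:
  assumes i: "i \<in> {1..n}"
  shows "\<bar>kde_error n x - kde_error n (x(i := y))\<bar> \<le> 2 / (real n * h n) * root 3 (h n * (\<integral>u. K u ^ 3 \<partial>lborel))"
  using kde_error_update_le[OF i, of x y] kde_error_update_le[OF i, of "x(i := y)" "x i"] by simp

lemma kde_error_measurable: "kde_error n \<in> borel_measurable (Pi\<^sub>M {1..n} (\<lambda>_. borel))"
proof -
  interpret finite_measure \<mu> by (rule interval_finite_measure)
  have [measurable]: "(\<lambda>z. snd z) \<in> borel_measurable (Pi\<^sub>M {1..n} (\<lambda>_. borel) \<Otimes>\<^sub>M \<mu>)"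
    by (rule interval_measurable[of _ _ t1 t2]) simp
  have [measurable]: "(\<lambda>z. fst z i) \<in> borel_measurable (Pi\<^sub>M {1..n} (\<lambda>_. borel) \<Otimes>\<^sub>M \<mu>)" if "i \<in> {1..n}" for i
    using that by measurable
  have "(\<lambda>z. \<bar>kernel_density_estimator K h (fst z) n (snd z) - f (snd z)\<bar> ^ 3)
      \<in> borel_measurable (Pi\<^sub>M {1..n} (\<lambda>_. borel) \<Otimes>\<^sub>M \<mu>)"
    unfolding kernel_density_estimator_def by measurable
  then have "(\<lambda>x. \<integral>t. \<bar>kernel_density_estimator K h x n t - f t\<bar> ^ 3 \<partial>\<mu>) \<in> borel_measurable (Pi\<^sub>M {1..n} (\<lambda>_. borel))"
    by (intro borel_measurable_lebesgue_integral) (simp add: case_prod_beta)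
  then show ?thesis
    unfolding kde_error_def cube_norm_def by measurable
qed

text \<open>The error splits into a centred random part and the bias; the factor \<open>4\<close>
  comes from \<open>abs_add_cube_le\<close> with unit weights. The nonnegative integral is the form
  in which Tonelli's theorem is applied next.\<close>

lemma kde_pointwise_error:
  assumes n: "n \<ge> 1" and t: "t1 \<le> t"
  defines "V \<equiv> B * (\<integral>u. K u ^ 3 \<partial>lborel) / (real n * h n)\<^sup>2 + 2 * B\<^sup>2 * (\<integral>u. (K u)\<^sup>2 \<partial>lborel) / (real n * h n)"
    and "b \<equiv> (L + B / t1) * h n * (\<integral>u. \<bar>u\<bar> * K u \<partial>lborel)"
  shows "(\<integral>\<^sup>+\<omega>. ennreal (\<bar>kernel_density_estimator K h (\<lambda>i. X i \<omega>) n t - f t\<bar> ^ 3) \<partial>M) \<le> ennreal (4 * (V + b ^ 3))"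
proof -
  let ?k = "\<lambda>\<omega>. kernel_density_estimator K h (\<lambda>i. X i \<omega>) n t"
  note dev = kde_abs_cube_deviation[where h = h, OF n h_pos[OF n], of t]
  have "(\<integral>\<^sup>+\<omega>. ennreal (\<bar>?k \<omega> - f t\<bar> ^ 3) \<partial>M)
      \<le> (\<integral>\<^sup>+\<omega>. ennreal (4 * (\<bar>?k \<omega> - smoothed (h n) t\<bar> ^ 3 + b ^ 3)) \<partial>M)"
  proof (intro nn_integral_mono ennreal_leI)
    fix \<omega>
    have "\<bar>?k \<omega> - f t\<bar> ^ 3 \<le> 4 * (\<bar>?k \<omega> - smoothed (h n) t\<bar> ^ 3 + \<bar>smoothed (h n) t - f t\<bar> ^ 3)"
      using abs_add_cube_le[of 1 1 "?k \<omega> - smoothed (h n) t" "smoothed (h n) t - f t"] by simp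
    also have "\<bar>smoothed (h n) t - f t\<bar> ^ 3 \<le> b ^ 3"
      unfolding b_def by (intro power_mono smoothed_bias h_pos n t t1_pos) simp
    finally show "\<bar>?k \<omega> - f t\<bar> ^ 3 \<le> 4 * (\<bar>?k \<omega> - smoothed (h n) t\<bar> ^ 3 + b ^ 3)" by simp
  qed
  also have "\<dots> = ennreal (expectation (\<lambda>\<omega>. 4 * (\<bar>?k \<omega> - smoothed (h n) t\<bar> ^ 3 + b ^ 3)))"
  proof (rule nn_integral_eq_integral)
    have "0 \<le> \<bar>smoothed (h n) t - f t\<bar>" by simp
    also have "\<dots> \<le> b" unfolding b_def by (intro smoothed_bias h_pos n t t1_pos)
    finally show "AE \<omega> in M. 0 \<le> 4 * (\<bar>?k \<omega> - smoothed (h n) t\<bar> ^ 3 + b ^ 3)" by simp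
  qed (use dev(1) in simp)
  also have "\<dots> = ennreal (4 * (expectation (\<lambda>\<omega>. \<bar>?k \<omega> - smoothed (h n) t\<bar> ^ 3) + b ^ 3))"
    using dev(1) by (simp add: prob_space)
  also have "\<dots> \<le> ennreal (4 * (V + b ^ 3))"
    using dev(2) unfolding V_def by (intro ennreal_leI) simp
  finally show ?thesis .
qed

text \<open>Tonelli's theorem exchanges the sample with the evaluation point, and the pointwise
  bound is uniform over the interval. Finiteness of the result also gives integrability.\<close>

lemma kde_error_moment:
  assumes n: "n \<ge> 1"
  defines "V \<equiv> B * (\<integral>u. K u ^ 3 \<partial>lborel) / (real n * h n)\<^sup>2 + 2 * B\<^sup>2 * (\<integral>u. (K u)\<^sup>2 \<partial>lborel) / (real n * h n)"
    and "b \<equiv> (L + B / t1) * h n * (\<integral>u. \<bar>u\<bar> * K u \<partial>lborel)"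
  shows "integrable M (\<lambda>\<omega>. kde_error n (\<lambda>i\<in>{1..n}. X i \<omega>) ^ 3)"
    and "expectation (\<lambda>\<omega>. kde_error n (\<lambda>i\<in>{1..n}. X i \<omega>) ^ 3) \<le> 4 * (V + b ^ 3) * measure \<mu> (space \<mu>)"
proof -
  interpret mu: finite_measure \<mu> by (rule interval_finite_measure)
  interpret pair: pair_sigma_finite M \<mu> ..
  let ?k = "\<lambda>\<omega>. kernel_density_estimator K h (\<lambda>i. X i \<omega>) n"
  have [measurable]: "(\<lambda>z. snd z) \<in> borel_measurable (M \<Otimes>\<^sub>M \<mu>)"
    by (rule interval_measurable[of _ _ t1 t2]) simp
  have [measurable]: "(\<lambda>z. X i (fst z)) \<in> borel_measurable (M \<Otimes>\<^sub>M \<mu>)" if "i \<in> {1..n}" for i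
    by (rule measurable_compose[OF measurable_fst X_meas]) (use that in simp)
  have meas: "(\<lambda>z. ennreal (\<bar>?k (fst z) (snd z) - f (snd z)\<bar> ^ 3)) \<in> borel_measurable (M \<Otimes>\<^sub>M \<mu>)"
    unfolding kernel_density_estimator_def by measurable
  have "0 \<le> V" using B_nonneg K_nonneg h_pos[OF n] unfolding V_def
    by (intro add_nonneg_nonneg divide_nonneg_nonneg mult_nonneg_nonneg Bochner_Integration.integral_nonneg) auto
  moreover have "0 \<le> b" using B_nonneg L_nonneg K_nonneg h_pos[OF n] t1_pos unfolding b_def
    by (intro mult_nonneg_nonneg add_nonneg_nonneg Bochner_Integration.integral_nonneg) auto
  ultimately have nn: "0 \<le> 4 * (V + b ^ 3)" by simp
  have "(\<integral>\<^sup>+\<omega>. ennreal (kde_error n (\<lambda>i\<in>{1..n}. X i \<omega>) ^ 3) \<partial>M)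
      = (\<integral>\<^sup>+\<omega>. (\<integral>\<^sup>+t. ennreal (\<bar>?k \<omega> t - f t\<bar> ^ 3) \<partial>\<mu>) \<partial>M)"
    unfolding kde_error_def cube_norm_power kernel_density_estimator_restrict
    by (intro nn_integral_cong nn_integral_eq_integral[symmetric] kde_diff_cube_integrable n) simp
  also have "\<dots> = (\<integral>\<^sup>+t. (\<integral>\<^sup>+\<omega>. ennreal (\<bar>?k \<omega> t - f t\<bar> ^ 3) \<partial>M) \<partial>\<mu>)"
    using meas by (intro pair.Fubini'[symmetric]) (simp add: case_prod_beta)
  also have "\<dots> \<le> (\<integral>\<^sup>+t. ennreal (4 * (V + b ^ 3)) \<partial>\<mu>)"
    unfolding V_def b_def
    by (intro nn_integral_mono kde_pointwise_error n) (simp add: space_restrict_space)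
  also have "\<dots> = ennreal (4 * (V + b ^ 3) * measure \<mu> (space \<mu>))"
    using nn by (simp add: mu.emeasure_eq_measure flip: ennreal_mult)
  finally have *: "(\<integral>\<^sup>+\<omega>. ennreal (kde_error n (\<lambda>i\<in>{1..n}. X i \<omega>) ^ 3) \<partial>M)
      \<le> ennreal (4 * (V + b ^ 3) * measure \<mu> (space \<mu>))" .
  have [measurable]: "(\<lambda>\<omega>. kde_error n (\<lambda>i\<in>{1..n}. X i \<omega>)) \<in> borel_measurable M"
    by (rule measurable_compose[OF _ kde_error_measurable]) (auto intro!: measurable_restrict X_meas)
  show "integrable M (\<lambda>\<omega>. kde_error n (\<lambda>i\<in>{1..n}. X i \<omega>) ^ 3)"
  proof (rule integrableI_bounded)
    have "(\<integral>\<^sup>+\<omega>. ennreal (norm (kde_error n (\<lambda>i\<in>{1..n}. X i \<omega>) ^ 3)) \<partial>M)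
        = (\<integral>\<^sup>+\<omega>. ennreal (kde_error n (\<lambda>i\<in>{1..n}. X i \<omega>) ^ 3) \<partial>M)"
      by (simp add: kde_error_nonneg)
    also have "\<dots> < \<infinity>" using le_less_trans[OF *] by simp
    finally show "(\<integral>\<^sup>+\<omega>. ennreal (norm (kde_error n (\<lambda>i\<in>{1..n}. X i \<omega>) ^ 3)) \<partial>M) < \<infinity>" .
  qed measurable
  show "expectation (\<lambda>\<omega>. kde_error n (\<lambda>i\<in>{1..n}. X i \<omega>) ^ 3) \<le> 4 * (V + b ^ 3) * measure \<mu> (space \<mu>)"
    by (rule integral_real_bounded[OF _ *]) (use nn in simp)
qed

text \<open>The third moment vanishes in the limit since \<open>real n * h n\<close> diverges and
  \<open>h n\<close> tends to zero. On a probability space this passes to the first moment.\<close>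

lemma expectation_kde_error_tendsto:
  assumes h_lim: "h \<longlonglongrightarrow> 0" and nh_lim: "filterlim (\<lambda>n. real n * h n) at_top sequentially"
  shows "(\<lambda>n. expectation (\<lambda>\<omega>. kde_error n (\<lambda>i\<in>{1..n}. X i \<omega>))) \<longlonglongrightarrow> 0"
proof -
  let ?e = "\<lambda>n \<omega>. kde_error n (\<lambda>i\<in>{1..n}. X i \<omega>)"
  let ?V = "\<lambda>n. B * (\<integral>u. K u ^ 3 \<partial>lborel) / (real n * h n)\<^sup>2 + 2 * B\<^sup>2 * (\<integral>u. (K u)\<^sup>2 \<partial>lborel) / (real n * h n)"
  let ?b = "\<lambda>n. (L + B / t1) * h n * (\<integral>u. \<bar>u\<bar> * K u \<partial>lborel)"
  have inv: "(\<lambda>n. c / (real n * h n)) \<longlonglongrightarrow> 0" for c :: real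
    by (rule real_tendsto_divide_at_top[OF tendsto_const nh_lim])
  have "(\<lambda>n. B * (\<integral>u. K u ^ 3 \<partial>lborel) * (1 / (real n * h n))\<^sup>2) \<longlonglongrightarrow> B * (\<integral>u. K u ^ 3 \<partial>lborel) * 0\<^sup>2"
    by (intro tendsto_mult tendsto_const tendsto_power inv)
  then have inv2: "(\<lambda>n. B * (\<integral>u. K u ^ 3 \<partial>lborel) / (real n * h n)\<^sup>2) \<longlonglongrightarrow> 0"
    by (simp add: power_divide)
  have "(\<lambda>n. 4 * (?V n + ?b n ^ 3) * measure \<mu> (space \<mu>))
      \<longlonglongrightarrow> 4 * ((0 + 0) + ((L + B / t1) * 0 * (\<integral>u. \<bar>u\<bar> * K u \<partial>lborel)) ^ 3) * measure \<mu> (space \<mu>)"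
    by (intro tendsto_mult tendsto_add tendsto_power tendsto_const inv inv2 h_lim)
  then have bound: "(\<lambda>n. 4 * (?V n + ?b n ^ 3) * measure \<mu> (space \<mu>)) \<longlonglongrightarrow> 0" by simp
  have cube: "(\<lambda>n. expectation (\<lambda>\<omega>. ?e n \<omega> ^ 3)) \<longlonglongrightarrow> 0"
  proof (rule tendsto_sandwich[OF _ _ tendsto_const bound])
    show "\<forall>\<^sub>F n in sequentially. 0 \<le> expectation (\<lambda>\<omega>. ?e n \<omega> ^ 3)"
      by (simp add: kde_error_nonneg)
    show "\<forall>\<^sub>F n in sequentially. expectation (\<lambda>\<omega>. ?e n \<omega> ^ 3) \<le> 4 * (?V n + ?b n ^ 3) * measure \<mu> (space \<mu>)"
      using eventually_ge_at_top[of 1] by eventually_elim (rule kde_error_moment(2))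
  qed
  have abs: "\<bar>?e n \<omega>\<bar> = ?e n \<omega>" for n \<omega> by (simp add: kde_error_nonneg)
  have meas: "?e n \<in> borel_measurable M" for n
    by (rule measurable_compose[OF _ kde_error_measurable]) (auto intro!: measurable_restrict X_meas)
  text \<open>The index \<open>0\<close> is skipped because nothing is known about \<open>h 0\<close>.\<close>
  have "(\<lambda>n. expectation (\<lambda>\<omega>. \<bar>?e (Suc n) \<omega>\<bar> ^ 1)) \<longlonglongrightarrow> 0"
  proof (rule tendsto_integral_abs_power)
    show "?e (Suc n) \<in> borel_measurable M" for n by (rule meas)
    show "(\<lambda>n. expectation (\<lambda>\<omega>. \<bar>?e (Suc n) \<omega>\<bar> ^ 3)) \<longlonglongrightarrow> 0"
      unfolding abs using cube by (rule LIMSEQ_Suc)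
    show "integrable M (\<lambda>\<omega>. \<bar>?e (Suc n) \<omega>\<bar> ^ 3)" for n
      unfolding abs by (rule kde_error_moment(1)) simp
  qed simp_all
  then show ?thesis
    unfolding abs power_one_right by (rule LIMSEQ_imp_Suc)
qed

text \<open>The left side is a constant times \<open>n powr - 1 * h n powr (- 2 / 3)\<close>. As the
  exponent of \<open>h n\<close> is negative, the lower bound on the bandwidth gives at most
  \<open>n powr (- 1 + 1 / 3)\<close>, the rate asked for by
  \<open>bounded_differences_AE_tendsto\<close>.\<close>

lemma kde_error_difference_rate:
  assumes h_large: "\<forall>\<^sub>F n in sequentially. real n powr (- 1 / 2) \<le> h n"
  shows "\<forall>\<^sub>F n in sequentially. 2 / (real n * h n) * root 3 (h n * (\<integral>u. K u ^ 3 \<partial>lborel))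
    \<le> 2 * root 3 (\<integral>u. K u ^ 3 \<partial>lborel) * real n powr (- 2 / 3)"
  using h_large eventually_ge_at_top[of 1]
proof eventually_elim
  case (elim n)
  have n: "real n > 0" and h: "h n > 0" using elim(2) h_pos[OF elim(2)] by auto
  have "1 / h n * root 3 (h n) = h n powr - 1 * h n powr (1 / 3)"
    using h by (simp add: root_powr_inverse powr_minus_divide)
  also have "\<dots> = h n powr (- 2 / 3)" by (simp only: flip: powr_add) simp
  also have "\<dots> \<le> (real n powr (- 1 / 2)) powr (- 2 / 3)"
    using elim(1) n by (intro powr_mono2') auto
  also have "\<dots> = real n powr (1 / 3)" by (simp add: powr_powr)
  finally have "1 / real n * (1 / h n * root 3 (h n)) \<le> 1 / real n * real n powr (1 / 3)"
    using n by (intro mult_left_mono) auto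
  also have "\<dots> = real n powr - 1 * real n powr (1 / 3)"
    using n by (simp add: powr_minus_divide)
  also have "\<dots> = real n powr (- 2 / 3)" by (simp only: flip: powr_add) simp
  finally have "2 * root 3 (\<integral>u. K u ^ 3 \<partial>lborel) * (1 / real n * (1 / h n * root 3 (h n)))
      \<le> 2 * root 3 (\<integral>u. K u ^ 3 \<partial>lborel) * real n powr (- 2 / 3)"
    using K_nonneg by (intro mult_left_mono) auto
  then show ?case by (simp add: real_root_mult mult_ac)
qed

lemma kde_error_AE_tendsto:
  assumes h_lim: "h \<longlonglongrightarrow> 0" and nh_lim: "filterlim (\<lambda>n. real n * h n) at_top sequentially"
    and h_large: "\<forall>\<^sub>F n in sequentially. real n powr (- 1 / 2) \<le> h n"
  shows "AE \<omega> in M. (\<lambda>n. cube_norm \<mu> (\<lambda>t. kernel_density_estimator K h (\<lambda>i. X i \<omega>) n t - f t)) \<longlonglongrightarrow> 0"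
proof -
  have "AE \<omega> in M. (\<lambda>n. kde_error n (\<lambda>i\<in>{1..n}. X i \<omega>)
      - expectation (\<lambda>\<omega>. kde_error n (\<lambda>i\<in>{1..n}. X i \<omega>))) \<longlonglongrightarrow> 0"
    by (rule bounded_differences_AE_tendsto[OF indep kde_error_measurable
          kde_error_bounded_differences kde_error_difference_rate[OF h_large]])
  then show ?thesis
  proof (rule AE_mp, intro AE_I2 impI)
    fix \<omega> assume "(\<lambda>n. kde_error n (\<lambda>i\<in>{1..n}. X i \<omega>)
      - expectation (\<lambda>\<omega>. kde_error n (\<lambda>i\<in>{1..n}. X i \<omega>))) \<longlonglongrightarrow> 0"
    from tendsto_add[OF this expectation_kde_error_tendsto[OF h_lim nh_lim]]
    have "(\<lambda>n. kde_error n (\<lambda>i\<in>{1..n}. X i \<omega>)) \<longlonglongrightarrow> 0"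
      by (simp del: restrict_apply)
    then show "(\<lambda>n. cube_norm \<mu> (\<lambda>t. kernel_density_estimator K h (\<lambda>i. X i \<omega>) n t - f t)) \<longlonglongrightarrow> 0"
      unfolding kde_error_def kernel_density_estimator_restrict .
  qed
qed

lemma kde_power_integral_tendsto:
  assumes "(\<lambda>n. cube_norm \<mu> (\<lambda>t. kernel_density_estimator K h x n t - f t)) \<longlonglongrightarrow> 0" and k: "k = 2 \<or> k = 3"
  shows "(\<lambda>n. LBINT t:{t1..t2}. kernel_density_estimator K h x n t ^ k) \<longlonglongrightarrow> (LBINT t:{t1..t2}. f t ^ k)"
proof -
  interpret finite_measure \<mu> by (rule interval_finite_measure)
  \<comment> \<open>The shift provides a positive sample size, for which the cube of the estimator
    is known to be integrable.\<close>
  have "(\<lambda>n. \<integral>t. kernel_density_estimator K h x (Suc n) t ^ k \<partial>\<mu>) \<longlonglongrightarrow> (\<integral>t. f t ^ k \<partial>\<mu>)"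
    using f_nonneg f_le
    by (intro tendsto_integral_power_of_cube_norm[where B = B] kde_measurable_interval f_measurable_interval
        kde_cube_integrable LIMSEQ_Suc[OF assms(1)] k) (auto simp: abs_le_iff intro: order.trans)
  then have "(\<lambda>n. \<integral>t. kernel_density_estimator K h x n t ^ k \<partial>\<mu>) \<longlonglongrightarrow> (\<integral>t. f t ^ k \<partial>\<mu>)"
    by (rule LIMSEQ_imp_Suc)
  then show ?thesis
    by (simp add: integral_restrict_space set_lebesgue_integral_def)
qed

end

text \<open>Replacing one observation moves the empirical distribution function by at most
  \<open>1 / n\<close>, well within \<open>n powr (- 2 / 3)\<close>, so the concentration result
  yields this strong law.\<close>

lemma empirical_cdf_AE_tendsto:
  "AE \<omega> in M. (\<lambda>n. empirical_cdf (\<lambda>i. X i \<omega>) n t) \<longlonglongrightarrow> cdf (distr M borel (X 1)) t"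
proof -
  let ?G = "\<lambda>n x. empirical_cdf x n t"
  have restr: "?G n (restrict x {1..n}) = ?G n x" for n x
    by (simp add: empirical_cdf_def)
  \<comment> \<open>A common density gives a common law, so the distribution function of
    \<open>X 1\<close> serves every index.\<close>
  have law: "distr M borel (X i) = distr M borel (X 1)" if "i \<ge> 1" for i
  proof -
    have "distr M borel (X j) = density lborel (\<lambda>x. ennreal (f x))" if "j \<ge> 1" for j
      using distributed_distr_eq_density[OF density[OF that]] by (simp cong: distr_cong)
    then show ?thesis using that by simp
  qed
  have E: "expectation (\<lambda>\<omega>. indicator {..t} (X i \<omega>)) = cdf (distr M borel (X 1)) t" if "i \<ge> 1" for i
  proof -
    have "expectation (\<lambda>\<omega>. indicator {..t} (X i \<omega>)) = (\<integral>x. indicat_real {..t} x \<partial>distr M borel (X i))"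
      using integral_distr[OF X_meas[OF that], of "indicator {..t} :: real \<Rightarrow> real"] by simp
    also have "\<dots> = cdf (distr M borel (X 1)) t"
      unfolding law[OF that] by (simp add: cdf_def)
    finally show ?thesis .
  qed
  have "AE \<omega> in M. (\<lambda>n. ?G n (\<lambda>i\<in>{1..n}. X i \<omega>) - expectation (\<lambda>\<omega>. ?G n (\<lambda>i\<in>{1..n}. X i \<omega>))) \<longlonglongrightarrow> 0"
  proof (rule bounded_differences_AE_tendsto[OF indep, where c = "\<lambda>n. 1 / real n" and C = 1])
    show "?G n \<in> borel_measurable (Pi\<^sub>M {1..n} (\<lambda>_. borel))" for n
      unfolding empirical_cdf_def by measurable
    show "\<bar>?G n x - ?G n (x(i := y))\<bar> \<le> 1 / real n" if "i \<in> {1..n}" for n x i y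
    proof -
      have "?G n x - ?G n (x(i := y)) = (indicator {..t} (x i) - indicator {..t} y) / real n"
        using sum_fun_upd[OF _ that, of "indicator {..t}" x y]
        by (simp add: empirical_cdf_def diff_divide_distrib add_divide_distrib del: fun_upd_apply)
      then show ?thesis by (simp add: divide_right_mono indicator_def)
    qed
    show "\<forall>\<^sub>F n in sequentially. 1 / real n \<le> 1 * real n powr (- 2 / 3)"
      by real_asymp
  qed
  then show ?thesis
  proof (rule AE_mp, intro AE_I2 impI)
    fix \<omega> assume *: "(\<lambda>n. ?G n (\<lambda>i\<in>{1..n}. X i \<omega>) - expectation (\<lambda>\<omega>. ?G n (\<lambda>i\<in>{1..n}. X i \<omega>))) \<longlonglongrightarrow> 0"
    \<comment> \<open>The empirical distribution function is unbiased for \<open>n \<ge> 1\<close>,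
      so the centring is eventually constant. For \<open>n = 0\<close> its value is
      \<open>0\<close>.\<close>
    have mean: "expectation (\<lambda>\<omega>. ?G n (\<lambda>i. X i \<omega>)) = cdf (distr M borel (X 1)) t" if "n \<ge> 1" for n
    proof -
      have int: "integrable M (\<lambda>\<omega>. indicator {..t} (X i \<omega>) :: real)" if "i \<in> {1..n}" for i
        using X_meas[of i] that by (intro integrable_const_bound[where B = 1]) (auto simp: indicator_def)
      have "expectation (\<lambda>\<omega>. ?G n (\<lambda>i. X i \<omega>))
          = 1 / real n * (\<Sum>i = 1..n. expectation (\<lambda>\<omega>. indicator {..t} (X i \<omega>)))"
        unfolding empirical_cdf_def using int by simp
      then show ?thesis using that E by simp
    qed
    have "(\<lambda>n. expectation (\<lambda>\<omega>. ?G n (\<lambda>i. X i \<omega>))) \<longlonglongrightarrow> cdf (distr M borel (X 1)) t"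
      by (rule tendsto_eventually, rule eventually_mono[OF eventually_ge_at_top[of 1]]) (rule mean)
    from tendsto_add[OF *[unfolded restr] this]
    show "(\<lambda>n. ?G n (\<lambda>i. X i \<omega>)) \<longlonglongrightarrow> cdf (distr M borel (X 1)) t" by simp
  qed
qed

end

text \<open>If \<open>f x\<close> exceeded \<open>1 + L\<close>, the density would stay above
  \<open>1\<close> on the unit interval to the right of \<open>x\<close>, giving total mass above
  \<open>1\<close>.\<close>

lemma lipschitz_density_le:
  fixes f :: "real \<Rightarrow> real"
  assumes int: "integrable lborel f" "(\<integral>x. f x \<partial>lborel) = 1"
    and nonneg: "\<And>x. f x \<ge> 0"
    and lip: "\<And>x y. 0 < x \<Longrightarrow> 0 < y \<Longrightarrow> \<bar>f x - f y\<bar> \<le> L * \<bar>x - y\<bar>"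
    and L: "L \<ge> 0" and x: "x > 0"
  shows "f x \<le> 1 + L"
proof -
  have "f x - L = (\<integral>y. indicator {x..x + 1} y * (f x - L) \<partial>lborel)"
    by simp
  also have "\<dots> \<le> (\<integral>y. f y \<partial>lborel)"
  proof (rule integral_mono[OF _ int(1)])
    fix y
    have "f x - L \<le> f y" if y: "y \<in> {x..x + 1}"
    proof -
      have "f x - f y \<le> L * \<bar>x - y\<bar>" using lip[of x y] x y by auto
      also have "\<dots> \<le> L * 1" using y L by (intro mult_left_mono) auto
      finally show ?thesis by simp
    qed
    then show "indicator {x..x + 1} y * (f x - L) \<le> f y"
      using nonneg[of y] by (auto simp: indicator_def)
  qed simp
  finally show ?thesis using int by simp
qed

text \<open>The iterated logarithm eventually exceeds \<open>1\<close>, so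
  \<open>inverse (h n) * real n powr (- 1 / 2)\<close> is eventually below \<open>1\<close>.\<close>

lemma bandwidth_lower_bound:
  fixes h :: "nat \<Rightarrow> real"
  assumes h_pos: "\<And>n. n \<ge> 1 \<Longrightarrow> h n > 0"
    and h_loglog: "(\<lambda>n. inverse (h n) * real n powr (- 1 / 2) * ln (ln (real n)) powr (1 / 2)) \<longlonglongrightarrow> 0"
  shows "\<forall>\<^sub>F n in sequentially. real n powr (- 1 / 2) \<le> h n"
proof -
  have "filterlim (\<lambda>n. ln (ln (real n)) powr (1 / 2)) at_top sequentially"
    by real_asymp
  then have "\<forall>\<^sub>F n in sequentially. 1 \<le> ln (ln (real n)) powr (1 / 2)"
    by (simp add: filterlim_at_top)
  with order_tendstoD(2)[OF h_loglog zero_less_one] eventually_ge_at_top[of 1]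
  show ?thesis
  proof eventually_elim
    case (elim n)
    have h: "h n > 0" using elim h_pos by blast
    have "inverse (h n) * real n powr (- 1 / 2) * 1
        \<le> inverse (h n) * real n powr (- 1 / 2) * ln (ln (real n)) powr (1 / 2)"
      using elim h by (intro mult_left_mono) auto
    also have "\<dots> < 1" by fact
    finally show ?case using h by (simp add: field_simps)
  qed
qed

text \<open>\<open>K_cube\<close> guarantees that the cube of the estimator is integrable over the
  interval, so that its integral is not the default value \<open>0\<close> of a nonintegrable
  function.\<close>

theorem theorem7:
  fixes M :: "'a measure" and X :: "nat \<Rightarrow> 'a \<Rightarrow> real"
    and f F K :: "real \<Rightarrow> real" and h :: "nat \<Rightarrow> real" and t1 t2 :: real
  assumes "prob_space M"
    and indep: "prob_space.indep_vars M (\<lambda>_. borel) X {1..}"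
    and density: "\<And>i. i \<ge> 1 \<Longrightarrow> distributed M lborel (X i) (\<lambda>x. ennreal (f x))"
    and f_nonneg: "\<And>x. f x \<ge> 0"
    and F_cdf: "F = cdf (distr M borel (X 1))"
    and f_support: "\<And>x. x \<notin> {0<..} \<Longrightarrow> f x = 0"
    and f_diff: "\<And>x. x > 0 \<Longrightarrow> f differentiable (at x)"
    and f_deriv_bounded: "bounded (deriv f ` {0<..})"
    and K_meas: "K \<in> borel_measurable borel"
    and K_nonneg: "\<And>t. K t \<ge> 0"
    and K_density: "has_bochner_integral lborel K 1"
    and K_moment: "integrable lborel (\<lambda>t. \<bar>t\<bar> * K t)"
    and K_cube: "integrable lborel (\<lambda>t. K t ^ 3)"
    and h_pos: "\<And>n. n \<ge> 1 \<Longrightarrow> h n > 0"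
    and h_lim: "h \<longlonglongrightarrow> 0"
    and nh_lim: "filterlim (\<lambda>n. real n * h n) at_top sequentially"
    and h_loglog: "(\<lambda>n. inverse (h n) * real n powr (- 1 / 2) * ln (ln (real n)) powr (1 / 2)) \<longlonglongrightarrow> 0"
    and t: "0 < t1" "t1 < t2" "F t1 < F t2"
  shows "AE \<omega> in M. (\<lambda>n. \<bar>interval_varextropy_estimator K h (\<lambda>i. X i \<omega>) n t1 t2
                          - interval_varextropy F f t1 t2\<bar>) \<longlonglongrightarrow> 0"
proof -
  interpret prob_space M by fact
  obtain L where L: "\<And>x. x > 0 \<Longrightarrow> \<bar>deriv f x\<bar> \<le> L"
    using f_deriv_bounded unfolding bounded_iff by force
  have L0: "L \<ge> 0" using L[of 1] by linarith
  have lip: "\<bar>f x - f y\<bar> \<le> L * \<bar>x - y\<bar>" if "0 < x" "0 < y" for x y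
  proof -
    have "norm (f x - f y) \<le> L * norm (x - y)"
    \<comment> \<open>Mean value inequality on the convex set of positive reals.\<close>
    proof (rule field_differentiable_bound[of "{0<..}" f "deriv f"])
      show "(f has_field_derivative deriv f z) (at z within {0<..})" if "z \<in> {0<..}" for z
        by (rule has_field_derivative_at_within)
          (use f_diff[of z] that in \<open>simp add: DERIV_deriv_iff_real_differentiable\<close>)
    qed (use L that in auto)
    then show ?thesis by simp
  qed
  \<comment> \<open>Transferring the constant function \<open>1\<close> through the density shows
    that \<open>f\<close> has total mass one.\<close>
  have int: "integrable lborel f" "(\<integral>x. f x \<partial>lborel) = 1"
    using distributed_integrable[OF density[of 1], of "\<lambda>_. 1 :: real"]
      distributed_integral[OF density[of 1], of "\<lambda>_. 1 :: real"] f_nonneg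
    by (auto simp: prob_space)
  have f_le: "f x \<le> 1 + L" for x
    using lipschitz_density_le[OF int f_nonneg lip L0] f_support[of x] L0 by (cases "x > 0") auto
  interpret kernel_density_sample M X f K "1 + L" L
    by unfold_locales (use assms f_le lip in auto)
  note h_large = bandwidth_lower_bound[OF h_pos h_loglog]
  have "AE \<omega> in M. (\<lambda>n. cube_norm (restrict_space lborel {t1..t2})
      (\<lambda>t. kernel_density_estimator K h (\<lambda>i. X i \<omega>) n t - f t)) \<longlonglongrightarrow> 0"
    by (rule kde_error_AE_tendsto[OF h_pos t(1) h_lim nh_lim h_large])
  \<comment> \<open>Outside the union of three null sets, the rest of the argument is
    deterministic.\<close>
  from this
    empirical_cdf_AE_tendsto[of t1] empirical_cdf_AE_tendsto[of t2]
  show ?thesis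
  proof eventually_elim
    case (elim \<omega>)
    let ?F = "empirical_cdf (\<lambda>i. X i \<omega>)" and ?f = "kernel_density_estimator K h (\<lambda>i. X i \<omega>)"
    have pow: "(\<lambda>n. LBINT t:{t1..t2}. ?f n t ^ k) \<longlonglongrightarrow> (LBINT t:{t1..t2}. f t ^ k)" if "k = 2 \<or> k = 3" for k
      by (rule kde_power_integral_tendsto[OF h_pos t(1) elim(1) that])
    have "(\<lambda>n. interval_varextropy (?F n) (?f n) t1 t2) \<longlonglongrightarrow> interval_varextropy F f t1 t2"
      unfolding interval_varextropy_def F_cdf
      \<comment> \<open>The limits of the denominators are nonzero because
        \<open>F t1 < F t2\<close>.\<close>
      by (intro tendsto_intros pow elim(2,3)) (use t(3) in \<open>simp_all add: F_cdf\<close>)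
    then have "(\<lambda>n. interval_varextropy_estimator K h (\<lambda>i. X i \<omega>) n t1 t2 - interval_varextropy F f t1 t2) \<longlonglongrightarrow> 0"
      unfolding interval_varextropy_estimator_def by (rule LIM_zero)
    then show ?case by (rule tendsto_rabs_zero)
  qed
qed

end
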